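(* Let $(R,d)$ be a dg-ring, and let $S$ be a multiplicative set of homogeneous elements of $R$. Assume that either $S$ consists of regular elements, or else $S\subseteq\ker(d)$ is an Ore set and the image of $S$ in $R/\mathrm{ass}(S)$ consists of regular elements of $R/\mathrm{ass}(S)$. Let $R_S$ be the Ore localisation of $R$ at $S$, with natural homomorphism $\lambda:R\to R_S$. Then $$d_S(b,s):=(-1)^{|s|+1}(d(s),s)\cdot(b,s)+(-1)^{|s|}(d(b),s)$$ defines a differential graded structure on $R_S$, and the natural homomorphism is a dg-ring homomorphism $\lambda:(R,d)\to(R_S,d_S)$ such that $\lambda(S)\subseteq R_S^\times$ and such that for any $q\in R_S$ there is $s\in S$ with $q\cdot\lambda(s)\in\mathrm{im}(\lambda)$.
   Context: A dg-ring $(R,d)$ is an associative unital $\mathbb Z$-graded ring $R$ with an additive endomorphism $d$ of degree $1$, $d^2=0$, satisfying $d(ab)=d(a)b+(-1)^{|a|}a\,d(b)$ for all $a,b\in R$ with $a$ homogeneous of degree $|a|$. Homomorphisms of dg-rings are degree-preserving ring homomorphisms commuting with the differentials. An element is regular if it is neither a left nor a right zero divisor. A multiplicative set is a non-empty multiplicatively closed subset. $\mathrm{ass}(S):=\{r\in R\mid\exists s\in S:\ rs=0\}$. $S$ is an Ore set if it satisfies the (right) Ore condition: for all $r\in R$, $s\in S$ there are $r'\in R$, $s'\in S$ with $rs'=sr'$; then $\mathrm{ass}(S)$ is a two-sided ideal. The Ore localisation $R_S$ is the (right) quotient ring of $R$ with respect to $S$: a ring with a ring homomorphism $\lambda:R\to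 R_S$ such that $\lambda(S)\subseteq R_S^\times$ (the group of invertible elements), $\ker\lambda=\mathrm{ass}(S)$, and every $q\in R_S$ satisfies $q\lambda(s)=\lambda(r)$ for some $s\in S$, $r\in R$. Its existence forces $S$ to satisfy the Ore condition, so this is understood also in the case where $S$ consists of regular elements. For $b\in R$ and $s\in S$ the symbol $(b,s)$ denotes the element $\lambda(s)^{-1}\lambda(b)$ of $R_S$; for homogeneous $b$ its degree is $|b|-|s|$. *)

theory Defs
  imports "HOL-Algebra.QuotRing"
begin

section \<open>Graded and differential graded rings\<close>

text \<open>Rings are the unital associative rings of HOL-Algebra; the zero ring is allowed. A grading is
  the family of homogeneous components, indexed by the integers, whose internal direct sum is the
  ring; so the degree of a homogeneous element \<open>a\<close> is any \<open>n\<close> with \<open>a \<in> G n\<close>, and is unique unless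
  \<open>a\<close> is zero.\<close>

locale graded_ring = ring R for R (structure) +
  fixes G :: "int \<Rightarrow> 'a set"
  assumes component_subgroup: "\<And>n. subgroup (G n) (add_monoid R)"
    and one_degree: "\<one> \<in> G 0"
    and mult_degree: "\<And>m n a b. \<lbrakk>a \<in> G m; b \<in> G n\<rbrakk> \<Longrightarrow> a \<otimes> b \<in> G (m + n)"
    and direct_sum: "\<And>x. x \<in> carrier R \<Longrightarrow>
      \<exists>!f. (\<forall>n. f n \<in> G n) \<and> finite {n. f n \<noteq> \<zero>} \<and> x = (\<Oplus>n\<in>{n. f n \<noteq> \<zero>}. f n)"

text \<open>\<open>signed R n x\<close> is $(-1)^n x$ for an integer \<open>n\<close>.\<close>

definition signed :: "('a, 'm) ring_scheme \<Rightarrow> int \<Rightarrow> 'a \<Rightarrow> 'a"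
  where "signed R n x = (if even n then x else \<ominus>\<^bsub>R\<^esub> x)"

locale dg_ring = graded_ring R G for R (structure) and G +
  fixes d :: "'a \<Rightarrow> 'a"
  assumes d_additive: "d \<in> hom (add_monoid R) (add_monoid R)"
    and d_degree: "\<And>n a. a \<in> G n \<Longrightarrow> d a \<in> G (n + 1)"
    and d_square: "\<And>a. a \<in> carrier R \<Longrightarrow> d (d a) = \<zero>"
    and d_Leibniz: "\<And>n a b. \<lbrakk>a \<in> G n; b \<in> carrier R\<rbrakk> \<Longrightarrow>
      d (a \<otimes> b) = d a \<otimes> b \<oplus> signed R n (a \<otimes> d b)"

definition dg_ring_hom ::
    "('a, 'm) ring_scheme \<Rightarrow> (int \<Rightarrow> 'a set) \<Rightarrow> ('a \<Rightarrow> 'a) \<Rightarrow>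
     ('b, 'n) ring_scheme \<Rightarrow> (int \<Rightarrow> 'b set) \<Rightarrow> ('b \<Rightarrow> 'b) \<Rightarrow> ('a \<Rightarrow> 'b) \<Rightarrow> bool"
  where "dg_ring_hom R G d R' G' d' h \<longleftrightarrow>
    h \<in> ring_hom R R' \<and> (\<forall>n. h ` G n \<subseteq> G' n) \<and> (\<forall>a\<in>carrier R. h (d a) = d' (h a))"

section \<open>Ore localisation\<close>

definition regular_element :: "('a, 'm) ring_scheme \<Rightarrow> 'a \<Rightarrow> bool"
  where "regular_element R a \<longleftrightarrow> a \<in> carrier R \<and>
    (\<forall>x\<in>carrier R. a \<otimes>\<^bsub>R\<^esub> x = \<zero>\<^bsub>R\<^esub> \<longrightarrow> x = \<zero>\<^bsub>R\<^esub>) \<and>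
    (\<forall>x\<in>carrier R. x \<otimes>\<^bsub>R\<^esub> a = \<zero>\<^bsub>R\<^esub> \<longrightarrow> x = \<zero>\<^bsub>R\<^esub>)"

text \<open>A multiplicative set need not contain the unit.\<close>

definition multiplicative_set :: "('a, 'm) ring_scheme \<Rightarrow> 'a set \<Rightarrow> bool"
  where "multiplicative_set R S \<longleftrightarrow>
    S \<noteq> {} \<and> S \<subseteq> carrier R \<and> (\<forall>s\<in>S. \<forall>t\<in>S. s \<otimes>\<^bsub>R\<^esub> t \<in> S)"

definition ass :: "('a, 'm) ring_scheme \<Rightarrow> 'a set \<Rightarrow> 'a set"
  where "ass R S = {r \<in> carrier R. \<exists>s\<in>S. r \<otimes>\<^bsub>R\<^esub> s = \<zero>\<^bsub>R\<^esub>}"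

definition ore_set :: "('a, 'm) ring_scheme \<Rightarrow> 'a set \<Rightarrow> bool"
  where "ore_set R S \<longleftrightarrow>
    (\<forall>r\<in>carrier R. \<forall>s\<in>S. \<exists>r'\<in>carrier R. \<exists>s'\<in>S. r \<otimes>\<^bsub>R\<^esub> s' = s \<otimes>\<^bsub>R\<^esub> r')"

definition ore_localisation ::
    "('a, 'm) ring_scheme \<Rightarrow> 'a set \<Rightarrow> ('b, 'n) ring_scheme \<Rightarrow> ('a \<Rightarrow> 'b) \<Rightarrow> bool"
  where "ore_localisation R S Q lam \<longleftrightarrow>
    ring Q \<and> lam \<in> ring_hom R Q \<and> lam ` S \<subseteq> Units Q \<and> a_kernel R Q lam = ass R S \<and>
    (\<forall>q\<in>carrier Q. \<exists>s\<in>S. \<exists>r\<in>carrier R. q \<otimes>\<^bsub>Q\<^esub> lam s = lam r)"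

text \<open>The symbol $(b,s)$. Although the localisation is on the right, this is a left fraction, and
  for a right Ore set not every element of \<open>Q\<close> need have this form.\<close>

definition ore_frac :: "('b, 'n) ring_scheme \<Rightarrow> ('a \<Rightarrow> 'b) \<Rightarrow> 'a \<Rightarrow> 'a \<Rightarrow> 'b"
  where "ore_frac Q lam b s = inv\<^bsub>Q\<^esub> (lam s) \<otimes>\<^bsub>Q\<^esub> lam b"

text \<open>For homogeneous \<open>b\<close>, the fraction $(b,s)$ has degree $|b|-|s|$.\<close>

definition fraction_grading ::
    "(int \<Rightarrow> 'a set) \<Rightarrow> 'a set \<Rightarrow> ('b, 'n) ring_scheme \<Rightarrow> ('a \<Rightarrow> 'b) \<Rightarrow> (int \<Rightarrow> 'b set) \<Rightarrow> bool"
  where "fraction_grading G S Q lam H \<longleftrightarrow>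
    (\<forall>m n. \<forall>b\<in>G m. \<forall>s\<in>S \<inter> G n. ore_frac Q lam b s \<in> H (m - n))"

definition fraction_differential ::
    "('a, 'm) ring_scheme \<Rightarrow> (int \<Rightarrow> 'a set) \<Rightarrow> ('a \<Rightarrow> 'a) \<Rightarrow> 'a set \<Rightarrow>
     ('b, 'n) ring_scheme \<Rightarrow> ('a \<Rightarrow> 'b) \<Rightarrow> ('b \<Rightarrow> 'b) \<Rightarrow> bool"
  where "fraction_differential R G d S Q lam dS \<longleftrightarrow>
    (\<forall>b\<in>carrier R. \<forall>n. \<forall>s\<in>S \<inter> G n.
      dS (ore_frac Q lam b s) =
        signed Q (n + 1) (ore_frac Q lam (d s) s \<otimes>\<^bsub>Q\<^esub> ore_frac Q lam b s)
        \<oplus>\<^bsub>Q\<^esub> signed Q n (ore_frac Q lam (d b) s))"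

end

theory Submission
  imports Defs "HOL-Algebra.Multiplicative_Group"
begin

text \<open>Let $\sigma$ be the automorphism of \<open>R\<close> acting as $(-1)^n$ in degree \<open>n\<close>. The graded Leibniz
  rule makes the map that sends \<open>r\<close> to the upper triangular matrix with rows $(\sigma(r), d(r))$
  and $(0, r)$ a ring homomorphism. Composed with \<open>lam\<close> it sends \<open>S\<close> to invertible triangular
  matrices over \<open>Q\<close>, so it extends to \<open>Q\<close> by the universal property, and the upper right entry of
  the extension is the differential. The grading of \<open>Q\<close> exists because right fractions have
  homogeneous common denominators; the sum is direct because \<open>ass R S\<close> is a homogeneous ideal.
  Degree, square zero and uniqueness follow by applying the Leibniz rule to an equation
  \<open>q \<otimes> lam s = lam r\<close> with homogeneous \<open>s\<close> and \<open>r\<close>, and cancelling the unit \<open>lam s\<close>.\<close>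

section \<open>Additive maps and signs\<close>

text \<open>The formula for the differential prescribes values on the left fractions
  \<open>ore_frac Q lam b s\<close> only, while \<open>Q\<close> is a localisation on the right,
  whose elements are products of \<open>lam r\<close> with the inverse of \<open>lam s\<close>. It
  cannot serve as a definition: it may miss elements of \<open>Q\<close>, and one element may have
  several presentations as a left fraction. So the differential is built on right fractions, and the
  formula is derived afterwards by solving the Leibniz rule for the value at a left fraction. The
  matrix ring reduces well-definedness and additivity to the universal property; multiplicativity
  becomes the Leibniz rule once the diagonal entries of the extension are known to be the sign and
  the identity. Uniqueness is possible although left fractions may not exhaust \<open>Q\<close>:
  they include all \<open>lam b\<close> and all inverses of \<open>lam s\<close>, and these generate
  \<open>Q\<close>.\<close>

lemma (in monoid) Units_r_cancel:
  assumes "x \<otimes> u = y \<otimes> u" "u \<in> Units G" "x \<in> carrier G" "y \<in> carrier G"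
  shows "x = y"
proof -
  have "x \<otimes> u \<otimes> inv u = y \<otimes> u \<otimes> inv u"
    using assms(1) by simp
  then show ?thesis
    using assms(2-4) by (simp add: m_assoc Units_closed)
qed

lemma additive_zero:
  assumes "abelian_group A" "abelian_group B" "f \<in> hom (add_monoid A) (add_monoid B)"
  shows "f \<zero>\<^bsub>A\<^esub> = \<zero>\<^bsub>B\<^esub>"
  using group_hom.hom_one[of "add_monoid A" "add_monoid B" f] assms
  by (simp add: group_hom_def group_hom_axioms_def abelian_group.a_group)

lemma additive_minus:
  assumes "abelian_group A" "abelian_group B" "f \<in> hom (add_monoid A) (add_monoid B)"
    and "x \<in> carrier A"
  shows "f (\<ominus>\<^bsub>A\<^esub> x) = \<ominus>\<^bsub>B\<^esub> f x"
  using group_hom.hom_inv[of "add_monoid A" "add_monoid B" f] assms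
  by (simp add: group_hom_def group_hom_axioms_def abelian_group.a_group a_inv_def)

lemma additive_finsum:
  assumes "abelian_group A" "abelian_group B" "f \<in> hom (add_monoid A) (add_monoid B)"
    and "g \<in> I \<rightarrow> carrier A"
  shows "f (finsum A g I) = finsum B (\<lambda>i. f (g i)) I"
proof -
  interpret A: abelian_group A by fact
  interpret B: abelian_group B by fact
  have zero: "f \<zero>\<^bsub>A\<^esub> = \<zero>\<^bsub>B\<^esub>"
    using additive_zero assms(1-3) by blast
  have closed: "f x \<in> carrier B" if "x \<in> carrier A" for x
    using assms(3) that by (auto simp: hom_def)
  have add: "f (x \<oplus>\<^bsub>A\<^esub> y) = f x \<oplus>\<^bsub>B\<^esub> f y" if "x \<in> carrier A" "y \<in> carrier A" for x y
    using assms(3) that by (auto simp: hom_def)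
  show ?thesis
    using assms(4)
    \<comment> \<open>Over an infinite index set both sums are zero by convention, and
      \<open>f\<close> preserves zero.\<close>
    by (induction I rule: infinite_finite_induct)
      (auto simp: zero closed add Pi_def A.finsum_infinite B.finsum_infinite)
qed

text \<open>The map with which the square of the differential is compared on homogeneous
  elements.\<close>

lemma (in abelian_group) additive_const_zero: "(\<lambda>x. \<zero>) \<in> hom (add_monoid G) (add_monoid G)"
  by (auto simp: hom_def)

section \<open>Arithmetic of the signs\<close>

context ring
begin

lemma signed_closed [simp]: "x \<in> carrier R \<Longrightarrow> signed R n x \<in> carrier R"
  by (simp add: signed_def)

lemma signed_zero [simp]: "signed R n \<zero> = \<zero>"
  by (simp add: signed_def)

lemma signed_add:
  "x \<in> carrier R \<Longrightarrow> y \<in> carrier R \<Longrightarrow> signed R n (x \<oplus> y) = signed R n x \<oplus> signed R n y"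
  by (simp add: signed_def minus_add)

lemma signed_mult_left:
  "x \<in> carrier R \<Longrightarrow> y \<in> carrier R \<Longrightarrow> signed R n x \<otimes> y = signed R n (x \<otimes> y)"
  by (simp add: signed_def l_minus)

lemma signed_mult_right:
  "x \<in> carrier R \<Longrightarrow> y \<in> carrier R \<Longrightarrow> x \<otimes> signed R n y = signed R n (x \<otimes> y)"
  by (simp add: signed_def r_minus)

lemma signed_signed: "x \<in> carrier R \<Longrightarrow> signed R m (signed R n x) = signed R (m + n) x"
  by (simp add: signed_def)

lemma signed_twice: "x \<in> carrier R \<Longrightarrow> signed R m (signed R (n + m) x) = signed R n x"
  "x \<in> carrier R \<Longrightarrow> signed R m (signed R m x) = x"
  by (simp_all add: signed_def)

lemma signed_even: "even n \<Longrightarrow> signed R n x = x"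
  by (simp add: signed_def)

lemma signed_succ: "x \<in> carrier R \<Longrightarrow> signed R (n + 1) x = \<ominus> signed R n x"
  by (simp add: signed_def)

lemma signed_Units:
  assumes u: "u \<in> Units R"
  shows "signed R n u \<in> Units R"
proof -
  have "\<ominus> (inv u) \<otimes> \<ominus> u = \<one>" "\<ominus> u \<otimes> \<ominus> (inv u) = \<one>"
    using u Units_closed[OF u] by (simp_all add: l_minus r_minus)
  then have "\<ominus> u \<in> Units R"
    using u Units_closed[OF u] unfolding Units_def[of R]
    by (intro CollectI conjI bexI[of _ "\<ominus> (inv u)"]) (simp_all add: Units_def)
  then show ?thesis
    using u by (simp add: signed_def)
qed

end

lemma signed_hom:
  assumes "abelian_group A" "abelian_group B" "f \<in> hom (add_monoid A) (add_monoid B)"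
    and "x \<in> carrier A"
  shows "f (signed A n x) = signed B n (f x)"
  using additive_minus[OF assms] by (simp add: signed_def)

section \<open>Graded rings and the parity automorphism\<close>

context graded_ring
begin

section \<open>Homogeneous components\<close>

definition component :: "'a \<Rightarrow> int \<Rightarrow> 'a"
  where "component x =
    (THE f. (\<forall>n. f n \<in> G n) \<and> finite {n. f n \<noteq> \<zero>} \<and> x = (\<Oplus>n\<in>{n. f n \<noteq> \<zero>}. f n))"

lemma degree_closed: "a \<in> G n \<Longrightarrow> a \<in> carrier R"
  using subgroup.subset[OF component_subgroup[of n]] by auto

lemma degree_zero: "\<zero> \<in> G n"
  using subgroup.one_closed[OF component_subgroup[of n]] by simp

lemma degree_add: "a \<in> G n \<Longrightarrow> b \<in> G n \<Longrightarrow> a \<oplus> b \<in> G n"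
  using subgroup.m_closed[OF component_subgroup[of n]] by simp

lemma degree_minus: "a \<in> G n \<Longrightarrow> \<ominus> a \<in> G n"
  using subgroup.m_inv_closed[OF component_subgroup[of n]] by (simp add: a_inv_def)

lemma degree_signed: "a \<in> G n \<Longrightarrow> signed R m a \<in> G n"
  by (simp add: signed_def degree_minus)

lemma component_props:
  assumes "x \<in> carrier R"
  shows "(\<forall>n. component x n \<in> G n) \<and> finite {n. component x n \<noteq> \<zero>} \<and>
    x = (\<Oplus>n\<in>{n. component x n \<noteq> \<zero>}. component x n)"
  unfolding component_def by (rule theI'[OF direct_sum[OF assms]])

lemma component_degree: "x \<in> carrier R \<Longrightarrow> component x n \<in> G n"
  and finite_support: "x \<in> carrier R \<Longrightarrow> finite {n. component x n \<noteq> \<zero>}"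
  and sum_components: "x \<in> carrier R \<Longrightarrow> (\<Oplus>n\<in>{n. component x n \<noteq> \<zero>}. component x n) = x"
  using component_props by auto

lemma component_closed [simp]: "x \<in> carrier R \<Longrightarrow> component x n \<in> carrier R"
  using component_degree degree_closed by blast

text \<open>The grading axiom sums over the exact support, but the support of a sum of two families
  is not determined by their supports. Passing to any larger finite set avoids this.\<close>

lemma finsum_support:
  assumes "finite A" "{n. f n \<noteq> \<zero>} \<subseteq> A" "\<And>n. f n \<in> carrier R"
  shows "(\<Oplus>n\<in>A. f n) = (\<Oplus>n\<in>{n. f n \<noteq> \<zero>}. f n)"
  by (rule add.finprod_mono_neutral_cong_right) (use assms in auto)

text \<open>The uniqueness half of \<open>direct_sum\<close>, in the form used to compute
  components: the index set may be larger than the support.\<close>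

lemma component_eqI:
  assumes "finite A" "\<And>n. f n \<in> G n" "\<And>n. n \<notin> A \<Longrightarrow> f n = \<zero>" "x = (\<Oplus>n\<in>A. f n)"
  shows "component x = f"
proof -
  have sub: "{n. f n \<noteq> \<zero>} \<subseteq> A"
    using assms(3) by auto
  have x: "x \<in> carrier R"
    using assms(2,4) degree_closed by (auto intro!: finsum_closed)
  have "x = (\<Oplus>n\<in>{n. f n \<noteq> \<zero>}. f n)"
    using finsum_support[OF assms(1) sub] assms(2,4) degree_closed by auto
  then have "(\<forall>n. f n \<in> G n) \<and> finite {n. f n \<noteq> \<zero>} \<and> x = (\<Oplus>n\<in>{n. f n \<noteq> \<zero>}. f n)"
    using assms(2) finite_subset[OF sub assms(1)] by auto
  with component_props[OF x] direct_sum[OF x] show ?thesis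
    by blast
qed

lemma component_homogeneous:
  assumes "x \<in> G n"
  shows "component x = (\<lambda>k. if k = n then x else \<zero>)"
  by (rule component_eqI[of "{n}"]) (use assms degree_zero degree_closed in auto)

lemma component_add:
  assumes x: "x \<in> carrier R" and y: "y \<in> carrier R"
  shows "component (x \<oplus> y) = (\<lambda>n. component x n \<oplus> component y n)"
proof (rule component_eqI)
  let ?X = "{n. component x n \<noteq> \<zero>}" and ?Y = "{n. component y n \<noteq> \<zero>}"
  show "finite (?X \<union> ?Y)"
    using finite_support assms by auto
  show "component x n \<oplus> component y n \<in> G n" for n
    using assms component_degree degree_add by auto
  show "component x n \<oplus> component y n = \<zero>" if "n \<notin> ?X \<union> ?Y" for n
    using that by auto
  have "x = (\<Oplus>n\<in>?X \<union> ?Y. component x n)" "y = (\<Oplus>n\<in>?X \<union> ?Y. component y n)"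
    using finsum_support[of "?X \<union> ?Y" "component x"] finsum_support[of "?X \<union> ?Y" "component y"]
      finite_support sum_components assms by auto
  then show "x \<oplus> y = (\<Oplus>n\<in>?X \<union> ?Y. component x n \<oplus> component y n)"
    using finsum_addf[of "component x" "?X \<union> ?Y" "component y"] assms by auto
qed

lemma component_additive:
  "(\<lambda>x. component x n) \<in> hom (add_monoid R) (add_monoid R)"
  by (auto simp: hom_def component_add)

lemma homogeneous_induct [consumes 1, case_names zero add homogeneous]:
  assumes "x \<in> carrier R" and zero: "P \<zero>"
    and add: "\<And>x y. x \<in> carrier R \<Longrightarrow> y \<in> carrier R \<Longrightarrow> P x \<Longrightarrow> P y \<Longrightarrow> P (x \<oplus> y)"
    and homogeneous: "\<And>n x. x \<in> G n \<Longrightarrow> P x"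
  shows "P x"
proof -
  have "P (\<Oplus>n\<in>A. component x n)" if "finite A" for A
    using that
    by (induction A)
      (use assms(1) in \<open>auto intro!: zero add homogeneous[OF component_degree]\<close>)
  from this[OF finite_support[OF assms(1)]] show ?thesis
    using sum_components[OF assms(1)] by simp
qed

text \<open>This spreads identities known in homogeneous degree, such as sign rules and the Leibniz
  rule, to the whole ring: it suffices that both sides are additive in the variable
  concerned.\<close>

lemma additive_eqI:
  assumes B: "abelian_group B"
    and f: "f \<in> hom (add_monoid R) (add_monoid B)" and g: "g \<in> hom (add_monoid R) (add_monoid B)"
    and eq: "\<And>n x. x \<in> G n \<Longrightarrow> f x = g x" and x: "x \<in> carrier R"
  shows "f x = g x"
  using x
proof (induction rule: homogeneous_induct)
  case zero
  then show ?case
    using eq degree_zero by blast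
next
  case (add x y)
  then show ?case
    using f g by (auto simp: hom_def)
qed (rule eq)

text \<open>Multiplication by a homogeneous \<open>s\<close> shifts the grading by \<open>m\<close>.
  Consequently, if \<open>x \<otimes> s\<close> is zero then \<open>s\<close> kills every component
  of \<open>x\<close>, which makes \<open>ass R S\<close> homogeneous.\<close>

lemma component_mult_right:
  assumes s: "s \<in> G m" and x: "x \<in> carrier R"
  shows "component (x \<otimes> s) (n + m) = component x n \<otimes> s"
proof (rule additive_eqI[OF abelian_group_axioms _ _ _ x])
  have s': "s \<in> carrier R"
    using s degree_closed by blast
  show "(\<lambda>x. component (x \<otimes> s) (n + m)) \<in> hom (add_monoid R) (add_monoid R)"
    using s' by (auto simp: hom_def component_add l_distr)
  show "(\<lambda>x. component x n \<otimes> s) \<in> hom (add_monoid R) (add_monoid R)"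
    using s' by (auto simp: hom_def component_add l_distr)
  show "component (x \<otimes> s) (n + m) = component x n \<otimes> s" if "x \<in> G k" for x k
    using component_homogeneous[OF that] component_homogeneous[OF mult_degree[OF that s]] s'
    by auto
qed

text \<open>The mirror image, used to extract a homogeneous factor \<open>u\<close> from an Ore
  equation \<open>r \<otimes> t = s \<otimes> u\<close>.\<close>

lemma component_mult_left:
  assumes s: "s \<in> G m" and x: "x \<in> carrier R"
  shows "component (s \<otimes> x) (m + n) = s \<otimes> component x n"
proof (rule additive_eqI[OF abelian_group_axioms _ _ _ x])
  have s': "s \<in> carrier R"
    using s degree_closed by blast
  show "(\<lambda>x. component (s \<otimes> x) (m + n)) \<in> hom (add_monoid R) (add_monoid R)"
    using s' by (auto simp: hom_def component_add r_distr)
  show "(\<lambda>x. s \<otimes> component x n) \<in> hom (add_monoid R) (add_monoid R)"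
    using s' by (auto simp: hom_def component_add r_distr)
  show "component (s \<otimes> x) (m + n) = s \<otimes> component x n" if "x \<in> G k" for x k
    using component_homogeneous[OF that] component_homogeneous[OF mult_degree[OF s that]] s'
    by auto
qed

text \<open>This is \<sigma>. It turns the sign of the Leibniz rule into a factor that makes sense
  for inhomogeneous elements too.\<close>

definition parity :: "'a \<Rightarrow> 'a"
  where "parity x = (\<Oplus>n\<in>{n. component x n \<noteq> \<zero>}. signed R n (component x n))"

lemma parity_eq:
  assumes "x \<in> carrier R" "finite A" "{n. component x n \<noteq> \<zero>} \<subseteq> A"
  shows "parity x = (\<Oplus>n\<in>A. signed R n (component x n))"
  unfolding parity_def
  by (rule add.finprod_mono_neutral_cong_left) (use assms in auto)

lemma parity_closed [simp]: "x \<in> carrier R \<Longrightarrow> parity x \<in> carrier R"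
  by (auto simp: parity_def intro!: finsum_closed)

lemma parity_homogeneous:
  assumes "x \<in> G n"
  shows "parity x = signed R n x"
  using parity_eq[of x "{n}"] degree_closed[OF assms]
  by (simp add: component_homogeneous[OF assms] Collect_conv_if)

lemma parity_add:
  assumes x: "x \<in> carrier R" and y: "y \<in> carrier R"
  shows "parity (x \<oplus> y) = parity x \<oplus> parity y"
proof -
  let ?A = "{n. component x n \<noteq> \<zero>} \<union> {n. component y n \<noteq> \<zero>}"
  have A: "finite ?A"
    using finite_support assms by auto
  have "parity (x \<oplus> y) = (\<Oplus>n\<in>?A. signed R n (component x n) \<oplus> signed R n (component y n))"
    by (subst parity_eq[OF _ A]) (use assms in \<open>auto simp: component_add signed_add\<close>)
  also have "\<dots> = parity x \<oplus> parity y"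
    by (subst finsum_addf) (use assms parity_eq[OF x A] parity_eq[OF y A] in auto)
  finally show ?thesis .
qed

text \<open>Both sides are additive in \<open>x\<close> and in \<open>y\<close> separately, so two
  reductions to homogeneous elements leave only the multiplicativity of the sign in the
  degree.\<close>

lemma parity_mult:
  assumes x: "x \<in> carrier R" and y: "y \<in> carrier R"
  shows "parity (x \<otimes> y) = parity x \<otimes> parity y"
proof (rule additive_eqI[OF abelian_group_axioms _ _ _ x])
  show "(\<lambda>x. parity (x \<otimes> y)) \<in> hom (add_monoid R) (add_monoid R)"
    "(\<lambda>x. parity x \<otimes> parity y) \<in> hom (add_monoid R) (add_monoid R)"
    using y by (auto simp: hom_def parity_add l_distr)
  fix n x
  assume x: "x \<in> G n"
  then have x': "x \<in> carrier R"
    by (rule degree_closed)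
  show "parity (x \<otimes> y) = parity x \<otimes> parity y"
  proof (rule additive_eqI[OF abelian_group_axioms _ _ _ y])
    show "(\<lambda>y. parity (x \<otimes> y)) \<in> hom (add_monoid R) (add_monoid R)"
      "(\<lambda>y. parity x \<otimes> parity y) \<in> hom (add_monoid R) (add_monoid R)"
      using x' by (auto simp: hom_def parity_add r_distr)
    fix m y
    assume y: "y \<in> G m"
    show "parity (x \<otimes> y) = parity x \<otimes> parity y"
      using x x' y degree_closed[OF y]
      by (simp add: parity_homogeneous[OF mult_degree[OF x y]] parity_homogeneous
          signed_mult_left signed_mult_right signed_signed add.commute)
  qed
qed

lemma parity_one: "parity \<one> = \<one>"
  using parity_homogeneous[OF one_degree] by (simp add: signed_def)

end

text \<open>Decompositions over an arbitrary finite set and vanishing of families with zero sum are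
  what computations with common denominators deliver. Two decompositions of \<open>x\<close> agree
  because their difference is a homogeneous family with sum zero.\<close>

lemma graded_ringI:
  assumes "ring R"
    and sub: "\<And>n. subgroup (G n) (add_monoid R)"
    and one: "\<one>\<^bsub>R\<^esub> \<in> G 0"
    and mult: "\<And>m n a b. a \<in> G m \<Longrightarrow> b \<in> G n \<Longrightarrow> a \<otimes>\<^bsub>R\<^esub> b \<in> G (m + n)"
    and ex: "\<And>x. x \<in> carrier R \<Longrightarrow>
      \<exists>A f. finite A \<and> (\<forall>n. f n \<in> G n) \<and> x = (\<Oplus>\<^bsub>R\<^esub>n\<in>A. f n)"
    and indep: "\<And>A f n. finite A \<Longrightarrow> (\<forall>n. f n \<in> G n) \<Longrightarrow> (\<Oplus>\<^bsub>R\<^esub>n\<in>A. f n) = \<zero>\<^bsub>R\<^esub> \<Longrightarrow> n \<in> A \<Longrightarrow> f n = \<zero>\<^bsub>R\<^esub>"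
  shows "graded_ring R G"
proof -
  interpret ring R by fact
  have closed: "a \<in> carrier R" if "a \<in> G n" for a n
    using subgroup.subset[OF sub[of n]] that by auto
  have zero: "\<zero>\<^bsub>R\<^esub> \<in> G n" for n
    using subgroup.one_closed[OF sub[of n]] by simp
  have add: "a \<oplus>\<^bsub>R\<^esub> b \<in> G n" if "a \<in> G n" "b \<in> G n" for a b n
    using subgroup.m_closed[OF sub[of n]] that by simp
  have minus: "\<ominus>\<^bsub>R\<^esub> a \<in> G n" if "a \<in> G n" for a n
    using subgroup.m_inv_closed[OF sub[of n]] that by (simp add: a_inv_def)
  have "\<exists>!f. (\<forall>n. f n \<in> G n) \<and> finite {n. f n \<noteq> \<zero>\<^bsub>R\<^esub>} \<and> x = (\<Oplus>\<^bsub>R\<^esub>n\<in>{n. f n \<noteq> \<zero>\<^bsub>R\<^esub>}. f n)"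
    if x: "x \<in> carrier R" for x
  proof (rule ex_ex1I)
    obtain A f where A: "finite A" and f: "\<forall>n. f n \<in> G n" "x = (\<Oplus>\<^bsub>R\<^esub>n\<in>A. f n)"
      using ex[OF x] by blast
    \<comment> \<open>Outside \<open>A\<close> the family \<open>f\<close> is arbitrary and might
      have infinite support, so it is cut off there.\<close>
    let ?g = "\<lambda>n. if n \<in> A then f n else \<zero>\<^bsub>R\<^esub>"
    have supp: "{n. ?g n \<noteq> \<zero>\<^bsub>R\<^esub>} \<subseteq> A"
      by auto
    have "x = (\<Oplus>\<^bsub>R\<^esub>n\<in>{n. ?g n \<noteq> \<zero>\<^bsub>R\<^esub>}. ?g n)"
      unfolding f(2)
      by (rule add.finprod_mono_neutral_cong_right) (use A f(1) closed in auto)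
    then have "(\<forall>n. ?g n \<in> G n) \<and> finite {n. ?g n \<noteq> \<zero>\<^bsub>R\<^esub>} \<and>
        x = (\<Oplus>\<^bsub>R\<^esub>n\<in>{n. ?g n \<noteq> \<zero>\<^bsub>R\<^esub>}. ?g n)"
      using f(1) zero finite_subset[OF supp A] by auto
    then show "\<exists>f. (\<forall>n. f n \<in> G n) \<and> finite {n. f n \<noteq> \<zero>\<^bsub>R\<^esub>} \<and>
        x = (\<Oplus>\<^bsub>R\<^esub>n\<in>{n. f n \<noteq> \<zero>\<^bsub>R\<^esub>}. f n)"
      by (rule exI[of _ ?g])
  next
    fix f g
    assume f: "(\<forall>n. f n \<in> G n) \<and> finite {n. f n \<noteq> \<zero>\<^bsub>R\<^esub>} \<and> x = (\<Oplus>\<^bsub>R\<^esub>n\<in>{n. f n \<noteq> \<zero>\<^bsub>R\<^esub>}. f n)"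
      and g: "(\<forall>n. g n \<in> G n) \<and> finite {n. g n \<noteq> \<zero>\<^bsub>R\<^esub>} \<and> x = (\<Oplus>\<^bsub>R\<^esub>n\<in>{n. g n \<noteq> \<zero>\<^bsub>R\<^esub>}. g n)"
    let ?A = "{n. f n \<noteq> \<zero>\<^bsub>R\<^esub>} \<union> {n. g n \<noteq> \<zero>\<^bsub>R\<^esub>}"
    have A: "finite ?A"
      using f g by auto
    have fc: "f n \<in> carrier R" and gc: "g n \<in> carrier R" for n
      using f g closed by auto
    have "(\<Oplus>\<^bsub>R\<^esub>n\<in>{n. f n \<noteq> \<zero>\<^bsub>R\<^esub>}. f n) = (\<Oplus>\<^bsub>R\<^esub>n\<in>?A. f n)"
      by (rule add.finprod_mono_neutral_cong_left) (use A fc in auto)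
    moreover have "(\<Oplus>\<^bsub>R\<^esub>n\<in>{n. g n \<noteq> \<zero>\<^bsub>R\<^esub>}. g n) = (\<Oplus>\<^bsub>R\<^esub>n\<in>?A. g n)"
      by (rule add.finprod_mono_neutral_cong_left) (use A gc in auto)
    ultimately have xf: "x = (\<Oplus>\<^bsub>R\<^esub>n\<in>?A. f n)" and xg: "x = (\<Oplus>\<^bsub>R\<^esub>n\<in>?A. g n)"
      using f g by auto
    have "(\<Oplus>\<^bsub>R\<^esub>n\<in>?A. \<ominus>\<^bsub>R\<^esub> g n) = \<ominus>\<^bsub>R\<^esub> x"
      unfolding xg
      by (rule additive_finsum[symmetric, OF abelian_group_axioms abelian_group_axioms])
        (use gc in \<open>auto simp: hom_def minus_add\<close>)
    then have "(\<Oplus>\<^bsub>R\<^esub>n\<in>?A. f n \<oplus>\<^bsub>R\<^esub> \<ominus>\<^bsub>R\<^esub> g n) = \<zero>\<^bsub>R\<^esub>"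
      by (subst finsum_addf) (use fc gc xf x in \<open>auto simp: r_neg\<close>)
    then have "f n \<oplus>\<^bsub>R\<^esub> \<ominus>\<^bsub>R\<^esub> g n = \<zero>\<^bsub>R\<^esub>" if "n \<in> ?A" for n
      using indep[OF A, of "\<lambda>n. f n \<oplus>\<^bsub>R\<^esub> \<ominus>\<^bsub>R\<^esub> g n"] f g that add minus by blast
    then have "f n = g n" if "n \<in> ?A" for n
      using fc gc that by (metis minus_equality minus_minus a_inv_closed)
    then show "f = g"
      by (intro ext) (metis (mono_tags, lifting) UnCI mem_Collect_eq)
  qed
  then show ?thesis
    using sub one mult by (intro graded_ring.intro graded_ring_axioms.intro ring_axioms)
qed

section \<open>The universal property of the Ore localisation\<close>

locale ore_localised = R: ring R + Q: ring Q
  for R (structure) and S and Q (structure) and lam +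
  assumes multiplicative: "multiplicative_set R S"
    and localisation: "ore_localisation R S Q lam"
begin

lemma lam_hom: "lam \<in> ring_hom R Q"
  using localisation by (simp add: ore_localisation_def)

lemma lam_closed [simp]: "r \<in> carrier R \<Longrightarrow> lam r \<in> carrier Q"
  using ring_hom_closed[OF lam_hom] .

lemma lam_mult: "r \<in> carrier R \<Longrightarrow> r' \<in> carrier R \<Longrightarrow> lam (r \<otimes>\<^bsub>R\<^esub> r') = lam r \<otimes>\<^bsub>Q\<^esub> lam r'"
  using ring_hom_mult[OF lam_hom] .

lemma lam_add: "r \<in> carrier R \<Longrightarrow> r' \<in> carrier R \<Longrightarrow> lam (r \<oplus>\<^bsub>R\<^esub> r') = lam r \<oplus>\<^bsub>Q\<^esub> lam r'"
  using ring_hom_add[OF lam_hom] .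

lemma lam_one: "lam \<one>\<^bsub>R\<^esub> = \<one>\<^bsub>Q\<^esub>"
  using ring_hom_one[OF lam_hom] .

lemma lam_additive: "lam \<in> hom (add_monoid R) (add_monoid Q)"
  by (auto simp: hom_def lam_add)

lemma lam_zero: "lam \<zero>\<^bsub>R\<^esub> = \<zero>\<^bsub>Q\<^esub>"
  by (rule additive_zero[OF R.abelian_group_axioms Q.abelian_group_axioms lam_additive])

lemma lam_minus: "r \<in> carrier R \<Longrightarrow> lam (\<ominus>\<^bsub>R\<^esub> r) = \<ominus>\<^bsub>Q\<^esub> lam r"
  by (rule additive_minus[OF R.abelian_group_axioms Q.abelian_group_axioms lam_additive])

lemma S_closed: "s \<in> S \<Longrightarrow> s \<in> carrier R"
  using multiplicative by (auto simp: multiplicative_set_def)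

lemma S_mult: "s \<in> S \<Longrightarrow> t \<in> S \<Longrightarrow> s \<otimes>\<^bsub>R\<^esub> t \<in> S"
  using multiplicative by (auto simp: multiplicative_set_def)

lemma S_nonempty: "\<exists>s. s \<in> S"
  using multiplicative by (auto simp: multiplicative_set_def)

lemma lam_Units: "s \<in> S \<Longrightarrow> lam s \<in> Units Q"
  using localisation by (auto simp: ore_localisation_def)

lemma fraction: "q \<in> carrier Q \<Longrightarrow> \<exists>s\<in>S. \<exists>r\<in>carrier R. q \<otimes>\<^bsub>Q\<^esub> lam s = lam r"
  using localisation by (auto simp: ore_localisation_def)

lemma lam_eq_zero:
  assumes "r \<in> carrier R" "lam r = \<zero>\<^bsub>Q\<^esub>"
  shows "\<exists>s\<in>S. r \<otimes>\<^bsub>R\<^esub> s = \<zero>\<^bsub>R\<^esub>"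
proof -
  have "r \<in> a_kernel R Q lam"
    using assms by (simp add: a_kernel_def')
  then show ?thesis
    using localisation by (auto simp: ore_localisation_def ass_def)
qed

lemma S_kills:
  assumes "r \<in> carrier R" "s \<in> S" "r \<otimes>\<^bsub>R\<^esub> s = \<zero>\<^bsub>R\<^esub>"
  shows "lam r = \<zero>\<^bsub>Q\<^esub>"
proof (rule Q.Units_r_cancel)
  show "lam r \<otimes>\<^bsub>Q\<^esub> lam s = \<zero>\<^bsub>Q\<^esub> \<otimes>\<^bsub>Q\<^esub> lam s"
    using assms S_closed by (simp add: lam_mult[symmetric] lam_zero)
qed (use assms lam_Units in auto)

text \<open>Lifts an equation from \<open>Q\<close> to \<open>R\<close> at the price of one factor
  from \<open>S\<close> on the right: the difference lies in the kernel, which is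
  \<open>ass R S\<close>.\<close>

lemma lam_eq:
  assumes "r \<in> carrier R" "r' \<in> carrier R" "lam r = lam r'"
  shows "\<exists>s\<in>S. r \<otimes>\<^bsub>R\<^esub> s = r' \<otimes>\<^bsub>R\<^esub> s"
proof -
  have "lam (r \<ominus>\<^bsub>R\<^esub> r') = \<zero>\<^bsub>Q\<^esub>"
    using assms by (simp add: R.minus_eq lam_add lam_minus Q.r_neg)
  then obtain s where s: "s \<in> S" "(r \<ominus>\<^bsub>R\<^esub> r') \<otimes>\<^bsub>R\<^esub> s = \<zero>\<^bsub>R\<^esub>"
    using lam_eq_zero assms by (meson R.minus_closed)
  have "r \<otimes>\<^bsub>R\<^esub> s \<ominus>\<^bsub>R\<^esub> r' \<otimes>\<^bsub>R\<^esub> s = \<zero>\<^bsub>R\<^esub>"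
    using s S_closed assms by (simp add: R.minus_eq R.l_distr R.l_minus)
  then have "r \<otimes>\<^bsub>R\<^esub> s = r' \<otimes>\<^bsub>R\<^esub> s"
    using R.r_right_minus_eq s(1) S_closed assms(1,2) by blast
  then show ?thesis
    using s(1) by blast
qed

text \<open>The left fraction with denominator \<open>s\<close> and numerator \<open>r\<close> is an
  element of \<open>Q\<close>, hence also a right fraction of \<open>u\<close> by \<open>t\<close>.
  Clearing denominators gives the Ore equation after applying \<open>lam\<close>; the factor
  \<open>w\<close> from \<open>lam_eq\<close> makes it hold in \<open>R\<close>.\<close>

lemma ore_condition:
  assumes r: "r \<in> carrier R" and s: "s \<in> S"
  shows "\<exists>t\<in>S. \<exists>u\<in>carrier R. r \<otimes>\<^bsub>R\<^esub> t = s \<otimes>\<^bsub>R\<^esub> u"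
proof -
  have s': "s \<in> carrier R" "lam s \<in> Units Q" "lam s \<in> carrier Q"
    using s S_closed lam_Units by auto
  let ?q = "inv\<^bsub>Q\<^esub> lam s \<otimes>\<^bsub>Q\<^esub> lam r"
  have "?q \<in> carrier Q"
    using s' r by simp
  then obtain t u where t: "t \<in> S" and u: "u \<in> carrier R" and q: "?q \<otimes>\<^bsub>Q\<^esub> lam t = lam u"
    using fraction by blast
  have t': "t \<in> carrier R"
    using t S_closed by blast
  have "lam (s \<otimes>\<^bsub>R\<^esub> u) = lam s \<otimes>\<^bsub>Q\<^esub> (?q \<otimes>\<^bsub>Q\<^esub> lam t)"
    using s' u q by (simp add: lam_mult)
  also have "\<dots> = (lam s \<otimes>\<^bsub>Q\<^esub> inv\<^bsub>Q\<^esub> lam s) \<otimes>\<^bsub>Q\<^esub> (lam r \<otimes>\<^bsub>Q\<^esub> lam t)"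
    using s' r t' Q.Units_inv_closed[OF s'(2)] by (simp add: Q.m_assoc del: Q.Units_r_inv)
  also have "\<dots> = lam (r \<otimes>\<^bsub>R\<^esub> t)"
    using s' r t' by (simp add: lam_mult)
  finally obtain w where w: "w \<in> S" "s \<otimes>\<^bsub>R\<^esub> u \<otimes>\<^bsub>R\<^esub> w = r \<otimes>\<^bsub>R\<^esub> t \<otimes>\<^bsub>R\<^esub> w"
    using lam_eq[of "s \<otimes>\<^bsub>R\<^esub> u" "r \<otimes>\<^bsub>R\<^esub> t"] s' u r t' by auto
  then have "r \<otimes>\<^bsub>R\<^esub> (t \<otimes>\<^bsub>R\<^esub> w) = s \<otimes>\<^bsub>R\<^esub> (u \<otimes>\<^bsub>R\<^esub> w)"
    using r t' s' u S_closed by (simp add: R.m_assoc)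
  then show ?thesis
    using S_mult[OF t w(1)] u w(1) S_closed R.m_closed by blast
qed

text \<open>The graph of the intended extension, which sends a right fraction of \<open>r\<close> by
  \<open>s\<close> to \<open>h r\<close> times the inverse of \<open>h s\<close>. As a relation it
  can be shown compatible with the ring operations before it is known to be single-valued, and this
  compatibility reduces single-valuedness to the fibre over zero.\<close>

definition extension_rel :: "('e, 'x) ring_scheme \<Rightarrow> ('a \<Rightarrow> 'e) \<Rightarrow> 'c \<Rightarrow> 'e \<Rightarrow> bool"
  where "extension_rel T h q y \<longleftrightarrow> q \<in> carrier Q \<and> y \<in> carrier T \<and>
    (\<exists>s\<in>S. \<exists>r\<in>carrier R. q \<otimes>\<^bsub>Q\<^esub> lam s = lam r \<and> y \<otimes>\<^bsub>T\<^esub> h s = h r)"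

end

section \<open>Extending a homomorphism that inverts \<open>S\<close>\<close>

locale ore_extension = ore_localised R S Q lam + T: ring T
  for R (structure) and S and Q (structure) and lam and T (structure) +
  fixes h
  assumes h_hom: "h \<in> ring_hom R T"
    and h_Units: "h ` S \<subseteq> Units T"
begin

lemma h_closed [simp]: "r \<in> carrier R \<Longrightarrow> h r \<in> carrier T"
  using ring_hom_closed[OF h_hom] .

lemma h_mult: "r \<in> carrier R \<Longrightarrow> r' \<in> carrier R \<Longrightarrow> h (r \<otimes>\<^bsub>R\<^esub> r') = h r \<otimes>\<^bsub>T\<^esub> h r'"
  using ring_hom_mult[OF h_hom] .

lemma h_add: "r \<in> carrier R \<Longrightarrow> r' \<in> carrier R \<Longrightarrow> h (r \<oplus>\<^bsub>R\<^esub> r') = h r \<oplus>\<^bsub>T\<^esub> h r'"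
  using ring_hom_add[OF h_hom] .

lemma h_one: "h \<one>\<^bsub>R\<^esub> = \<one>\<^bsub>T\<^esub>"
  using ring_hom_one[OF h_hom] .

lemma h_zero: "h \<zero>\<^bsub>R\<^esub> = \<zero>\<^bsub>T\<^esub>"
  by (rule additive_zero[OF R.abelian_group_axioms T.abelian_group_axioms])
    (auto simp: hom_def h_add)

lemma h_unit: "s \<in> S \<Longrightarrow> h s \<in> Units T"
  using h_Units by blast

lemma rel_lam:
  assumes "r \<in> carrier R"
  shows "extension_rel T h (lam r) (h r)"
proof -
  \<comment> \<open>As \<open>S\<close> may lack the unit, \<open>lam r\<close> is presented with
    numerator \<open>r \<otimes> s\<close> and denominator \<open>s\<close>.\<close>
  obtain s where "s \<in> S"
    using S_nonempty by blast
  then show ?thesis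
    using assms S_closed[of s] unfolding extension_rel_def
    by (intro conjI bexI[of _ s] bexI[of _ "r \<otimes>\<^bsub>R\<^esub> s"])
      (simp_all add: lam_mult h_mult)
qed

lemma rel_total:
  assumes "q \<in> carrier Q"
  shows "\<exists>y. extension_rel T h q y"
proof -
  obtain s r where s: "s \<in> S" "r \<in> carrier R" "q \<otimes>\<^bsub>Q\<^esub> lam s = lam r"
    using fraction[OF assms] by blast
  have "h r \<otimes>\<^bsub>T\<^esub> inv\<^bsub>T\<^esub> h s \<otimes>\<^bsub>T\<^esub> h s = h r"
    using s h_unit[OF s(1)] by (simp add: T.m_assoc S_closed)
  then show ?thesis
    using s assms h_unit[OF s(1)] unfolding extension_rel_def
    by (intro exI[of _ "h r \<otimes>\<^bsub>T\<^esub> inv\<^bsub>T\<^esub> h s"]) auto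
qed

lemma rel_add:
  assumes "extension_rel T h q y" "extension_rel T h q' y'"
  shows "extension_rel T h (q \<oplus>\<^bsub>Q\<^esub> q') (y \<oplus>\<^bsub>T\<^esub> y')"
proof -
  obtain s r where s: "s \<in> S" "r \<in> carrier R" and q: "q \<otimes>\<^bsub>Q\<^esub> lam s = lam r" "y \<otimes>\<^bsub>T\<^esub> h s = h r"
    using assms(1) by (auto simp: extension_rel_def)
  obtain s' r' where s': "s' \<in> S" "r' \<in> carrier R"
    and q': "q' \<otimes>\<^bsub>Q\<^esub> lam s' = lam r'" "y' \<otimes>\<^bsub>T\<^esub> h s' = h r'"
    using assms(2) by (auto simp: extension_rel_def)
  have closed: "q \<in> carrier Q" "q' \<in> carrier Q" "y \<in> carrier T" "y' \<in> carrier T"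
    "s \<in> carrier R" "s' \<in> carrier R"
    using assms s s' S_closed by (auto simp: extension_rel_def)
  \<comment> \<open>Here \<open>u\<close> need not lie in \<open>S\<close>, but the common value
    \<open>s \<otimes> t\<close> does and becomes the denominator of the sum.\<close>
  obtain t u where t: "t \<in> S" "u \<in> carrier R" and st: "s \<otimes>\<^bsub>R\<^esub> t = s' \<otimes>\<^bsub>R\<^esub> u"
    using ore_condition[OF closed(5) s'(1)] by blast
  have t': "t \<in> carrier R"
    using t S_closed by blast
  have "(q \<oplus>\<^bsub>Q\<^esub> q') \<otimes>\<^bsub>Q\<^esub> lam (s \<otimes>\<^bsub>R\<^esub> t) = q \<otimes>\<^bsub>Q\<^esub> lam (s \<otimes>\<^bsub>R\<^esub> t) \<oplus>\<^bsub>Q\<^esub> q' \<otimes>\<^bsub>Q\<^esub> lam (s' \<otimes>\<^bsub>R\<^esub> u)"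
    using closed t' t(2) by (simp add: Q.l_distr st)
  also have "\<dots> = lam (r \<otimes>\<^bsub>R\<^esub> t \<oplus>\<^bsub>R\<^esub> r' \<otimes>\<^bsub>R\<^esub> u)"
    using closed s s' t' t q q' by (simp add: lam_mult lam_add Q.m_assoc[symmetric])
  finally have 1: "(q \<oplus>\<^bsub>Q\<^esub> q') \<otimes>\<^bsub>Q\<^esub> lam (s \<otimes>\<^bsub>R\<^esub> t) = lam (r \<otimes>\<^bsub>R\<^esub> t \<oplus>\<^bsub>R\<^esub> r' \<otimes>\<^bsub>R\<^esub> u)" .
  have "(y \<oplus>\<^bsub>T\<^esub> y') \<otimes>\<^bsub>T\<^esub> h (s \<otimes>\<^bsub>R\<^esub> t) = y \<otimes>\<^bsub>T\<^esub> h (s \<otimes>\<^bsub>R\<^esub> t) \<oplus>\<^bsub>T\<^esub> y' \<otimes>\<^bsub>T\<^esub> h (s' \<otimes>\<^bsub>R\<^esub> u)"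
    using closed t' t(2) by (simp add: T.l_distr st)
  also have "\<dots> = h (r \<otimes>\<^bsub>R\<^esub> t \<oplus>\<^bsub>R\<^esub> r' \<otimes>\<^bsub>R\<^esub> u)"
    using closed s s' t' t q q' by (simp add: h_mult h_add T.m_assoc[symmetric])
  finally have 2: "(y \<oplus>\<^bsub>T\<^esub> y') \<otimes>\<^bsub>T\<^esub> h (s \<otimes>\<^bsub>R\<^esub> t) = h (r \<otimes>\<^bsub>R\<^esub> t \<oplus>\<^bsub>R\<^esub> r' \<otimes>\<^bsub>R\<^esub> u)" .
  show ?thesis
    unfolding extension_rel_def using 1 2 closed s s' t t' S_mult
    by (intro conjI bexI[of _ "s \<otimes>\<^bsub>R\<^esub> t"]
        bexI[of _ "r \<otimes>\<^bsub>R\<^esub> t \<oplus>\<^bsub>R\<^esub> r' \<otimes>\<^bsub>R\<^esub> u"]) auto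
qed

text \<open>The Ore equation \<open>r' \<otimes> t = s \<otimes> u\<close> moves the inverse of
  \<open>s\<close> to the right past \<open>r'\<close>, so that the product has numerator
  \<open>r \<otimes> u\<close> and denominator \<open>s' \<otimes> t\<close>.\<close>

lemma rel_mult:
  assumes "extension_rel T h q y" "extension_rel T h q' y'"
  shows "extension_rel T h (q \<otimes>\<^bsub>Q\<^esub> q') (y \<otimes>\<^bsub>T\<^esub> y')"
proof -
  obtain s r where s: "s \<in> S" "r \<in> carrier R" and q: "q \<otimes>\<^bsub>Q\<^esub> lam s = lam r" "y \<otimes>\<^bsub>T\<^esub> h s = h r"
    using assms(1) by (auto simp: extension_rel_def)
  obtain s' r' where s': "s' \<in> S" "r' \<in> carrier R"
    and q': "q' \<otimes>\<^bsub>Q\<^esub> lam s' = lam r'" "y' \<otimes>\<^bsub>T\<^esub> h s' = h r'"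
    using assms(2) by (auto simp: extension_rel_def)
  have closed: "q \<in> carrier Q" "q' \<in> carrier Q" "y \<in> carrier T" "y' \<in> carrier T"
    "s \<in> carrier R" "s' \<in> carrier R"
    using assms s s' S_closed by (auto simp: extension_rel_def)
  obtain t u where t: "t \<in> S" "u \<in> carrier R" and rt: "r' \<otimes>\<^bsub>R\<^esub> t = s \<otimes>\<^bsub>R\<^esub> u"
    using ore_condition[OF s'(2) s(1)] by blast
  have t': "t \<in> carrier R"
    using t S_closed by blast
  have "q \<otimes>\<^bsub>Q\<^esub> q' \<otimes>\<^bsub>Q\<^esub> lam (s' \<otimes>\<^bsub>R\<^esub> t) = q \<otimes>\<^bsub>Q\<^esub> (q' \<otimes>\<^bsub>Q\<^esub> lam s' \<otimes>\<^bsub>Q\<^esub> lam t)"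
    using closed t' by (simp add: lam_mult Q.m_assoc)
  also have "\<dots> = q \<otimes>\<^bsub>Q\<^esub> lam (s \<otimes>\<^bsub>R\<^esub> u)"
    using s' t' by (simp add: q' lam_mult[symmetric] rt)
  also have "\<dots> = lam (r \<otimes>\<^bsub>R\<^esub> u)"
    using closed s t by (simp add: lam_mult Q.m_assoc[symmetric] q)
  finally have 1: "q \<otimes>\<^bsub>Q\<^esub> q' \<otimes>\<^bsub>Q\<^esub> lam (s' \<otimes>\<^bsub>R\<^esub> t) = lam (r \<otimes>\<^bsub>R\<^esub> u)" .
  have "y \<otimes>\<^bsub>T\<^esub> y' \<otimes>\<^bsub>T\<^esub> h (s' \<otimes>\<^bsub>R\<^esub> t) = y \<otimes>\<^bsub>T\<^esub> (y' \<otimes>\<^bsub>T\<^esub> h s' \<otimes>\<^bsub>T\<^esub> h t)"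
    using closed t' by (simp add: h_mult T.m_assoc)
  also have "\<dots> = y \<otimes>\<^bsub>T\<^esub> h (s \<otimes>\<^bsub>R\<^esub> u)"
    using s' t' by (simp add: q' h_mult[symmetric] rt)
  also have "\<dots> = h (r \<otimes>\<^bsub>R\<^esub> u)"
    using closed s t by (simp add: h_mult T.m_assoc[symmetric] q)
  finally have 2: "y \<otimes>\<^bsub>T\<^esub> y' \<otimes>\<^bsub>T\<^esub> h (s' \<otimes>\<^bsub>R\<^esub> t) = h (r \<otimes>\<^bsub>R\<^esub> u)" .
  show ?thesis
    unfolding extension_rel_def using 1 2 closed s s' t t' S_mult
    by (intro conjI bexI[of _ "s' \<otimes>\<^bsub>R\<^esub> t"] bexI[of _ "r \<otimes>\<^bsub>R\<^esub> u"]) auto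
qed

text \<open>Negation is multiplication by the image of minus one, so it is covered by
  \<open>rel_lam\<close> and \<open>rel_mult\<close>.\<close>

lemma rel_minus:
  assumes "extension_rel T h q y"
  shows "extension_rel T h (\<ominus>\<^bsub>Q\<^esub> q) (\<ominus>\<^bsub>T\<^esub> y)"
proof -
  have "extension_rel T h (lam (\<ominus>\<^bsub>R\<^esub> \<one>\<^bsub>R\<^esub>)) (h (\<ominus>\<^bsub>R\<^esub> \<one>\<^bsub>R\<^esub>))"
    by (rule rel_lam) simp
  moreover have "h (\<ominus>\<^bsub>R\<^esub> \<one>\<^bsub>R\<^esub>) = \<ominus>\<^bsub>T\<^esub> \<one>\<^bsub>T\<^esub>"
    by (subst additive_minus[OF R.abelian_group_axioms T.abelian_group_axioms])
      (auto simp: hom_def h_add h_one)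
  ultimately have "extension_rel T h (\<ominus>\<^bsub>Q\<^esub> \<one>\<^bsub>Q\<^esub>) (\<ominus>\<^bsub>T\<^esub> \<one>\<^bsub>T\<^esub>)"
    by (simp add: lam_minus lam_one)
  from rel_mult[OF this assms] show ?thesis
    using assms by (simp add: extension_rel_def Q.l_minus T.l_minus)
qed

text \<open>An element of the kernel of \<open>lam\<close> is killed by some element of
  \<open>S\<close>, which \<open>h\<close> makes invertible; hence \<open>h\<close> vanishes on that
  kernel. Cancelling the unit \<open>h s\<close> then kills \<open>y\<close>.\<close>

lemma rel_zero:
  assumes "extension_rel T h \<zero>\<^bsub>Q\<^esub> y"
  shows "y = \<zero>\<^bsub>T\<^esub>"
proof -
  obtain s r where s: "s \<in> S" "r \<in> carrier R" and r: "lam r = \<zero>\<^bsub>Q\<^esub>" "y \<otimes>\<^bsub>T\<^esub> h s = h r"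
    and y: "y \<in> carrier T"
    using assms by (auto simp: extension_rel_def S_closed)
  obtain t where t: "t \<in> S" "r \<otimes>\<^bsub>R\<^esub> t = \<zero>\<^bsub>R\<^esub>"
    using lam_eq_zero s(2) r(1) by blast
  have "h r \<otimes>\<^bsub>T\<^esub> h t = \<zero>\<^bsub>T\<^esub> \<otimes>\<^bsub>T\<^esub> h t"
    using t s S_closed by (simp add: h_mult[symmetric] h_zero)
  then have "h r = \<zero>\<^bsub>T\<^esub>"
    by (rule T.Units_r_cancel) (use h_unit[OF t(1)] s in auto)
  then have "y \<otimes>\<^bsub>T\<^esub> h s = \<zero>\<^bsub>T\<^esub> \<otimes>\<^bsub>T\<^esub> h s"
    using r(2) s S_closed by simp
  then show ?thesis
    by (rule T.Units_r_cancel) (use h_unit[OF s(1)] y in auto)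
qed

lemma rel_functional:
  assumes "extension_rel T h q y" "extension_rel T h q y'"
  shows "y = y'"
proof -
  have "extension_rel T h \<zero>\<^bsub>Q\<^esub> (y \<ominus>\<^bsub>T\<^esub> y')"
    using rel_add[OF assms(1) rel_minus[OF assms(2)]] assms
    by (simp add: T.minus_eq extension_rel_def Q.r_neg)
  then show ?thesis
    using rel_zero T.r_right_minus_eq assms unfolding extension_rel_def by blast
qed

theorem universal_property: "\<exists>g\<in>ring_hom Q T. \<forall>r\<in>carrier R. g (lam r) = h r"
proof -
  define g where "g q = (THE y. extension_rel T h q y)" for q
  have rel: "extension_rel T h q (g q)" if "q \<in> carrier Q" for q
    unfolding g_def using rel_total[OF that] rel_functional by (metis theI)
  have eq: "g q = y" if "extension_rel T h q y" for q y
    using rel_functional[OF rel that] that by (auto simp: extension_rel_def)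
  have lam: "g (lam r) = h r" if "r \<in> carrier R" for r
    using eq rel_lam that by blast
  have "g \<in> ring_hom Q T"
  proof (rule ring_hom_memI)
    show "g q \<in> carrier T" if "q \<in> carrier Q" for q
      using rel[OF that] by (simp add: extension_rel_def)
    show "g (q \<otimes>\<^bsub>Q\<^esub> q') = g q \<otimes>\<^bsub>T\<^esub> g q'" if "q \<in> carrier Q" "q' \<in> carrier Q" for q q'
      using eq rel_mult rel that by blast
    show "g (q \<oplus>\<^bsub>Q\<^esub> q') = g q \<oplus>\<^bsub>T\<^esub> g q'" if "q \<in> carrier Q" "q' \<in> carrier Q" for q q'
      using eq rel_add rel that by blast
    show "g \<one>\<^bsub>Q\<^esub> = \<one>\<^bsub>T\<^esub>"
      using lam[of "\<one>\<^bsub>R\<^esub>"] by (simp add: lam_one h_one)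
  qed
  with lam show ?thesis
    by blast
qed

end

section \<open>The grading of the localisation\<close>

locale graded_ore_localised = R: graded_ring R G + ore_localised R S Q lam
  for R (structure) and G and S and Q (structure) and lam +
  assumes homogeneous: "s \<in> S \<Longrightarrow> \<exists>n. s \<in> G n"
begin

text \<open>Right fractions of degree \<open>n\<close>, being the difference of the degrees of
  \<open>r\<close> and \<open>s\<close>. Unlike left fractions, right fractions reach every element
  of \<open>Q\<close>, so the components are described by them.\<close>

definition fraction_degree :: "int \<Rightarrow> 'c set"
  where "fraction_degree n =
    {q \<in> carrier Q. \<exists>m. \<exists>s\<in>S \<inter> G m. \<exists>r\<in>G (n + m). q \<otimes>\<^bsub>Q\<^esub> lam s = lam r}"

lemma fraction_degreeI:
  "q \<in> carrier Q \<Longrightarrow> s \<in> S \<Longrightarrow> s \<in> G m \<Longrightarrow> r \<in> G (n + m) \<Longrightarrow> q \<otimes>\<^bsub>Q\<^esub> lam s = lam r \<Longrightarrow>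
    q \<in> fraction_degree n"
  by (auto simp: fraction_degree_def)

lemma fraction_degreeE:
  assumes "q \<in> fraction_degree n"
  obtains m s r where "q \<in> carrier Q" "s \<in> S" "s \<in> carrier R" "s \<in> G m" "r \<in> carrier R"
    "r \<in> G (n + m)" "q \<otimes>\<^bsub>Q\<^esub> lam s = lam r"
  using assms S_closed R.degree_closed by (auto simp: fraction_degree_def)

text \<open>The element \<open>t\<close> is homogeneous since it lies in \<open>S\<close>, so
  \<open>r \<otimes> t\<close> has degree \<open>k + j\<close>. Comparing components in that degree
  permits replacing \<open>u\<close> by its component of degree \<open>k + j - m\<close>.\<close>

lemma homogeneous_ore_condition:
  assumes r: "r \<in> G k" and s: "s \<in> S" "s \<in> G m"
  shows "\<exists>j. \<exists>t\<in>S \<inter> G j. \<exists>u\<in>G (k + j - m). r \<otimes>\<^bsub>R\<^esub> t = s \<otimes>\<^bsub>R\<^esub> u"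
proof -
  obtain t u where t: "t \<in> S" "u \<in> carrier R" and eq: "r \<otimes>\<^bsub>R\<^esub> t = s \<otimes>\<^bsub>R\<^esub> u"
    using ore_condition[OF R.degree_closed[OF r] s(1)] by blast
  obtain j where j: "t \<in> G j"
    using homogeneous[OF t(1)] by blast
  have "r \<otimes>\<^bsub>R\<^esub> t = R.component (r \<otimes>\<^bsub>R\<^esub> t) (k + j)"
    using R.component_homogeneous[OF R.mult_degree[OF r j]] by simp
  also have "\<dots> = s \<otimes>\<^bsub>R\<^esub> R.component u (k + j - m)"
    using R.component_mult_left[OF s(2) t(2), of "k + j - m"] by (simp add: eq)
  finally show ?thesis
    using t j R.component_degree[OF t(2)] by blast
qed

lemma fraction_degree_closed: "q \<in> fraction_degree n \<Longrightarrow> q \<in> carrier Q"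
  by (simp add: fraction_degree_def)

lemma lam_degree:
  assumes "r \<in> G n"
  shows "lam r \<in> fraction_degree n"
proof -
  obtain s m where s: "s \<in> S" "s \<in> G m"
    using S_nonempty homogeneous by blast
  show ?thesis
    by (rule fraction_degreeI[OF _ s(1) s(2) R.mult_degree[OF assms s(2)]])
      (use assms s S_closed R.degree_closed lam_mult in auto)
qed

lemma fraction_degree_mult:
  assumes "q \<in> fraction_degree n" "q' \<in> fraction_degree n'"
  shows "q \<otimes>\<^bsub>Q\<^esub> q' \<in> fraction_degree (n + n')"
proof -
  obtain m s r where s: "q \<in> carrier Q" "s \<in> S" "s \<in> carrier R" "s \<in> G m" "r \<in> carrier R"
    "r \<in> G (n + m)" "q \<otimes>\<^bsub>Q\<^esub> lam s = lam r"
    using assms(1) by (rule fraction_degreeE)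
  obtain m' s' r' where s': "q' \<in> carrier Q" "s' \<in> S" "s' \<in> carrier R" "s' \<in> G m'"
    "r' \<in> carrier R" "r' \<in> G (n' + m')" "q' \<otimes>\<^bsub>Q\<^esub> lam s' = lam r'"
    using assms(2) by (rule fraction_degreeE)
  obtain j t u where t: "t \<in> S" "t \<in> G j" "u \<in> G (n' + m' + j - m)" "r' \<otimes>\<^bsub>R\<^esub> t = s \<otimes>\<^bsub>R\<^esub> u"
    using homogeneous_ore_condition[OF s'(6) s(2,4)] by blast
  have t': "t \<in> carrier R" "u \<in> carrier R"
    using t S_closed R.degree_closed by auto
  have "q \<otimes>\<^bsub>Q\<^esub> q' \<otimes>\<^bsub>Q\<^esub> lam (s' \<otimes>\<^bsub>R\<^esub> t) = q \<otimes>\<^bsub>Q\<^esub> (q' \<otimes>\<^bsub>Q\<^esub> lam s' \<otimes>\<^bsub>Q\<^esub> lam t)"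
    using s s'(1-5) t' by (simp add: lam_mult Q.m_assoc)
  also have "\<dots> = q \<otimes>\<^bsub>Q\<^esub> lam (s \<otimes>\<^bsub>R\<^esub> u)"
    using s' t' by (simp add: lam_mult[symmetric] t)
  also have "\<dots> = lam (r \<otimes>\<^bsub>R\<^esub> u)"
    using s t' by (simp add: lam_mult Q.m_assoc[symmetric])
  finally have "q \<otimes>\<^bsub>Q\<^esub> q' \<otimes>\<^bsub>Q\<^esub> lam (s' \<otimes>\<^bsub>R\<^esub> t) = lam (r \<otimes>\<^bsub>R\<^esub> u)" .
  moreover have "r \<otimes>\<^bsub>R\<^esub> u \<in> G (n + n' + (m' + j))"
    using R.mult_degree[OF s(6) t(3)] by (simp add: algebra_simps)
  ultimately show ?thesis
    using s(1) s'(1) S_mult[OF s'(2) t(1)] R.mult_degree[OF s'(4) t(2)]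
    by (intro fraction_degreeI) auto
qed

text \<open>The index type and the degree function \<open>e\<close> are left general for two uses:
  families over the integers with \<open>e n = n\<close> for independence, and two elements of equal
  degree, indexed by booleans, for sums.\<close>

lemma common_denominator:
  assumes "finite A" "\<And>n. n \<in> A \<Longrightarrow> f n \<in> fraction_degree (e n)"
  shows "\<exists>m. \<exists>s\<in>S \<inter> G m. \<exists>r. \<forall>n\<in>A. r n \<in> G (e n + m) \<and> f n \<otimes>\<^bsub>Q\<^esub> lam s = lam (r n)"
  using assms
proof (induction A)
  case empty
  then show ?case
    using S_nonempty homogeneous by blast
next
  case (insert a A)
  then obtain m s r where s: "s \<in> S" "s \<in> G m"
    and r: "\<And>n. n \<in> A \<Longrightarrow> r n \<in> G (e n + m) \<and> f n \<otimes>\<^bsub>Q\<^esub> lam s = lam (r n)"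
    by (metis IntE insertCI)
  obtain m' s' r' where s': "f a \<in> carrier Q" "s' \<in> S" "s' \<in> carrier R" "s' \<in> G m'"
    "r' \<in> carrier R" "r' \<in> G (e a + m')" "f a \<otimes>\<^bsub>Q\<^esub> lam s' = lam r'"
    using insert.prems[of a] fraction_degreeE by blast
  obtain j t u where t: "t \<in> S" "t \<in> G j" "u \<in> G (m + j - m')" and st: "s \<otimes>\<^bsub>R\<^esub> t = s' \<otimes>\<^bsub>R\<^esub> u"
    using homogeneous_ore_condition[OF s(2) s'(2,4)] by blast
  have closed: "s \<in> carrier R" "t \<in> carrier R" "u \<in> carrier R"
    using s t S_closed R.degree_closed by auto
  \<comment> \<open>The new denominator is \<open>s \<otimes> t = s' \<otimes> u\<close>: old
    numerators are multiplied by \<open>t\<close>, the one belonging to \<open>a\<close> by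
    \<open>u\<close>.\<close>
  define r'' where "r'' n = (if n = a then r' \<otimes>\<^bsub>R\<^esub> u else r n \<otimes>\<^bsub>R\<^esub> t)" for n
  have "r'' n \<in> G (e n + (m + j)) \<and> f n \<otimes>\<^bsub>Q\<^esub> lam (s \<otimes>\<^bsub>R\<^esub> t) = lam (r'' n)"
    if "n \<in> insert a A" for n
  proof (cases "n = a")
    case True
    have "f a \<otimes>\<^bsub>Q\<^esub> lam (s' \<otimes>\<^bsub>R\<^esub> u) = lam (r' \<otimes>\<^bsub>R\<^esub> u)"
      using s' closed by (simp add: lam_mult Q.m_assoc[symmetric])
    then show ?thesis
      using R.mult_degree[OF s'(6) t(3)] True by (simp add: r''_def st algebra_simps)
  next
    case False
    then have n: "n \<in> A"
      using that by blast
    have "f n \<in> carrier Q" "r n \<in> carrier R"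
      using insert.prems[of n] n fraction_degree_closed r[OF n] R.degree_closed by blast+
    then have "f n \<otimes>\<^bsub>Q\<^esub> lam (s \<otimes>\<^bsub>R\<^esub> t) = lam (r n \<otimes>\<^bsub>R\<^esub> t)"
      using r[OF n] closed by (simp add: lam_mult Q.m_assoc[symmetric])
    then show ?thesis
      using R.mult_degree[OF _ t(2)] r[OF n] False by (auto simp: r''_def add.assoc[symmetric])
  qed
  then show ?case
    using S_mult[OF s(1) t(1)] R.mult_degree[OF s(2) t(2)] by blast
qed

lemma fraction_degree_add:
  assumes "q \<in> fraction_degree n" "q' \<in> fraction_degree n"
  shows "q \<oplus>\<^bsub>Q\<^esub> q' \<in> fraction_degree n"
proof -
  have "\<exists>m. \<exists>s\<in>S \<inter> G m. \<exists>r. \<forall>b\<in>UNIV. r b \<in> G (n + m) \<and> (if b then q else q') \<otimes>\<^bsub>Q\<^esub> lam s = lam (r b)"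
    by (rule common_denominator) (use assms in auto)
  then obtain m s r where s: "s \<in> S" "s \<in> G m" and r: "\<And>b. r b \<in> G (n + m)"
    and eq: "\<And>b. (if b then q else q') \<otimes>\<^bsub>Q\<^esub> lam s = lam (r b)"
    by blast
  have closed: "q \<in> carrier Q" "q' \<in> carrier Q" "s \<in> carrier R" "\<And>b. r b \<in> carrier R"
    using assms fraction_degree_closed s S_closed R.degree_closed[OF r] by auto
  have "(q \<oplus>\<^bsub>Q\<^esub> q') \<otimes>\<^bsub>Q\<^esub> lam s = lam (r True \<oplus>\<^bsub>R\<^esub> r False)"
    using closed eq[of True] eq[of False] by (simp add: Q.l_distr lam_add)
  then show ?thesis
    using closed s R.degree_add[OF r r] by (intro fraction_degreeI) auto
qed

lemma fraction_degree_minus: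
  assumes "q \<in> fraction_degree n"
  shows "\<ominus>\<^bsub>Q\<^esub> q \<in> fraction_degree n"
proof -
  obtain m s r where s: "q \<in> carrier Q" "s \<in> S" "s \<in> carrier R" "s \<in> G m" "r \<in> carrier R"
    "r \<in> G (n + m)" "q \<otimes>\<^bsub>Q\<^esub> lam s = lam r"
    using assms by (rule fraction_degreeE)
  then show ?thesis
    using R.degree_minus[OF s(6)]
    by (intro fraction_degreeI[of _ s m "\<ominus>\<^bsub>R\<^esub> r"]) (auto simp: Q.l_minus lam_minus)
qed

text \<open>Clearing a common denominator of degree \<open>m\<close> turns the relation into
  \<open>lam x = \<zero>\<close> with \<open>x\<close> the sum of the numerators, so some
  homogeneous \<open>t\<close> in \<open>S\<close> kills \<open>x\<close>. It then kills each
  component of \<open>x\<close>, and these are the numerators, which lie in the distinct degrees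
  \<open>n + m\<close>.\<close>

lemma fraction_degree_independent:
  assumes A: "finite A" and f: "\<forall>n. f n \<in> fraction_degree n"
    and sum: "(\<Oplus>\<^bsub>Q\<^esub>n\<in>A. f n) = \<zero>\<^bsub>Q\<^esub>" and n: "n \<in> A"
  shows "f n = \<zero>\<^bsub>Q\<^esub>"
proof -
  obtain m s r where s: "s \<in> S" "s \<in> G m" and r: "\<And>n. n \<in> A \<Longrightarrow> r n \<in> G (n + m)"
    and eq: "\<And>n. n \<in> A \<Longrightarrow> f n \<otimes>\<^bsub>Q\<^esub> lam s = lam (r n)"
    using common_denominator[of A f "\<lambda>n. n"] A f by blast
  have s': "s \<in> carrier R"
    using s S_closed by blast
  have rc: "r \<in> A \<rightarrow> carrier R" and fc: "f n \<in> carrier Q" for n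
    using r R.degree_closed f fraction_degree_closed by blast+
  define x where "x = (\<Oplus>\<^bsub>R\<^esub>n\<in>A. r n)"
  have x: "x \<in> carrier R"
    unfolding x_def using rc by (rule R.finsum_closed)
  have "lam x = (\<Oplus>\<^bsub>Q\<^esub>n\<in>A. lam (r n))"
    unfolding x_def
    by (rule additive_finsum[OF R.abelian_group_axioms Q.abelian_group_axioms lam_additive rc])
  also have "\<dots> = (\<Oplus>\<^bsub>Q\<^esub>n\<in>A. f n \<otimes>\<^bsub>Q\<^esub> lam s)"
    by (rule Q.finsum_cong') (use fc s' eq in auto)
  also have "\<dots> = \<zero>\<^bsub>Q\<^esub>"
    using sum Q.finsum_ldistr[OF A, of "lam s" f] fc s' by auto
  finally obtain t where t: "t \<in> S" "x \<otimes>\<^bsub>R\<^esub> t = \<zero>\<^bsub>R\<^esub>"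
    using lam_eq_zero[OF x] by blast
  obtain k where k: "t \<in> G k"
    using homogeneous[OF t(1)] by blast
  have "R.component x (n + m) = (\<Oplus>\<^bsub>R\<^esub>i\<in>A. R.component (r i) (n + m))"
    unfolding x_def
    by (rule additive_finsum[OF R.abelian_group_axioms R.abelian_group_axioms
          R.component_additive rc])
  also have "\<dots> = (\<Oplus>\<^bsub>R\<^esub>i\<in>A. if n = i then r i else \<zero>\<^bsub>R\<^esub>)"
    by (rule R.finsum_cong')
      (use rc R.component_homogeneous[OF r] in auto)
  also have "\<dots> = r n"
    by (rule R.finsum_singleton[OF n A rc])
  finally have "r n \<otimes>\<^bsub>R\<^esub> t = R.component (x \<otimes>\<^bsub>R\<^esub> t) (n + m + k)"
    using R.component_mult_right[OF k x, of "n + m"] by simp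
  then have "r n \<otimes>\<^bsub>R\<^esub> t = \<zero>\<^bsub>R\<^esub>"
    using R.component_homogeneous[OF R.degree_zero[of 0]] t(2) by simp
  then have "lam (r n) = \<zero>\<^bsub>Q\<^esub>"
    using S_kills t(1) rc n by blast
  then have "f n \<otimes>\<^bsub>Q\<^esub> lam s = \<zero>\<^bsub>Q\<^esub> \<otimes>\<^bsub>Q\<^esub> lam s"
    using eq[OF n] s' by simp
  then show ?thesis
    by (rule Q.Units_r_cancel) (use lam_Units[OF s(1)] fc in auto)
qed

lemma fraction_degree_one: "\<one>\<^bsub>Q\<^esub> \<in> fraction_degree 0"
  using lam_degree[OF R.one_degree] by (simp add: lam_one)

lemma fraction_degree_inv:
  assumes "s \<in> S" "s \<in> G n"
  shows "inv\<^bsub>Q\<^esub> lam s \<in> fraction_degree (- n)"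
  using assms lam_Units[OF assms(1)] R.one_degree
  by (intro fraction_degreeI[of _ s n "\<one>\<^bsub>R\<^esub>"]) (simp_all add: lam_one)

text \<open>The denominator is already homogeneous, so decomposing the numerator is enough.\<close>

lemma fraction_degree_exists:
  assumes q: "q \<in> carrier Q"
  shows "\<exists>A f. finite A \<and> (\<forall>n. f n \<in> fraction_degree n) \<and> q = (\<Oplus>\<^bsub>Q\<^esub>n\<in>A. f n)"
proof -
  obtain s r where s: "s \<in> S" and r: "r \<in> carrier R" and eq: "q \<otimes>\<^bsub>Q\<^esub> lam s = lam r"
    using fraction[OF q] by blast
  obtain m where m: "s \<in> G m"
    using homogeneous[OF s] by blast
  let ?v = "inv\<^bsub>Q\<^esub> lam s"
  let ?A = "{n. R.component r n \<noteq> \<zero>\<^bsub>R\<^esub>}"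
  \<comment> \<open>Dividing by \<open>s\<close> of degree \<open>m\<close> lowers degrees by
    \<open>m\<close>; this explains the shift here and in the index set below.\<close>
  let ?f = "\<lambda>n. lam (R.component r (n + m)) \<otimes>\<^bsub>Q\<^esub> ?v"
  have unit: "lam s \<in> Units Q" "?v \<in> carrier Q"
    using lam_Units[OF s] by auto
  have "(\<Oplus>\<^bsub>Q\<^esub>n\<in>(\<lambda>n. n - m) ` ?A. ?f n) = (\<Oplus>\<^bsub>Q\<^esub>n\<in>?A. ?f (n - m))"
    using unit(2) r by (intro Q.finsum_reindex) (simp_all add: Pi_def inj_on_def)
  also have "\<dots> = (\<Oplus>\<^bsub>Q\<^esub>n\<in>?A. lam (R.component r n)) \<otimes>\<^bsub>Q\<^esub> ?v"
    using Q.finsum_ldistr[OF R.finite_support[OF r] unit(2), of "\<lambda>n. lam (R.component r n)"] r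
    by (simp add: Pi_def)
  also have "(\<Oplus>\<^bsub>Q\<^esub>n\<in>?A. lam (R.component r n)) = lam (\<Oplus>\<^bsub>R\<^esub>n\<in>?A. R.component r n)"
    using r by (intro additive_finsum[symmetric, OF R.abelian_group_axioms
          Q.abelian_group_axioms lam_additive]) (simp add: Pi_def)
  also have "\<dots> = q \<otimes>\<^bsub>Q\<^esub> lam s"
    using R.sum_components[OF r] eq by simp
  also have "\<dots> \<otimes>\<^bsub>Q\<^esub> ?v = q"
    using unit q Q.Units_closed by (simp add: Q.m_assoc)
  finally have "q = (\<Oplus>\<^bsub>Q\<^esub>n\<in>(\<lambda>n. n - m) ` ?A. ?f n)"
    by (rule sym)
  moreover have "?f n \<in> fraction_degree n" for n
    using fraction_degree_mult[OF lam_degree[OF R.component_degree[OF r, of "n + m"]]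
        fraction_degree_inv[OF s m]] by simp
  ultimately show ?thesis
    using R.finite_support[OF r]
    by (intro exI[of _ "(\<lambda>n. n - m) ` ?A"] exI[of _ ?f] conjI allI finite_imageI)
qed

lemma fraction_graded_ring: "graded_ring Q fraction_degree"
proof (rule graded_ringI[OF Q.ring_axioms])
  show "subgroup (fraction_degree n) (add_monoid Q)" for n
  proof (rule group.subgroupI[OF Q.a_group])
    show "fraction_degree n \<noteq> {}"
      using lam_degree[OF R.degree_zero] by blast
    show "inv\<^bsub>add_monoid Q\<^esub> q \<in> fraction_degree n" if "q \<in> fraction_degree n" for q
      using fraction_degree_minus[OF that] by (simp add: a_inv_def)
  qed (use fraction_degree_closed fraction_degree_add in auto)
qed (fact fraction_degree_one fraction_degree_mult fraction_degree_exists
    fraction_degree_independent)+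

lemma fraction_degree_fraction_grading: "fraction_grading G S Q lam fraction_degree"
  unfolding fraction_grading_def ore_frac_def
proof (intro allI ballI)
  fix m n b s
  assume "b \<in> G m" "s \<in> S \<inter> G n"
  then show "inv\<^bsub>Q\<^esub> lam s \<otimes>\<^bsub>Q\<^esub> lam b \<in> fraction_degree (m - n)"
    using fraction_degree_mult[OF fraction_degree_inv lam_degree, of s n b m] by simp
qed

text \<open>The conditions on gradings and differentials speak about left fractions only; this makes
  them applicable to \<open>lam b\<close>, with a denominator taken from \<open>S\<close>, which may
  lack the unit.\<close>

lemma lam_as_left_fraction:
  assumes "s \<in> S" "b \<in> carrier R"
  shows "lam b = ore_frac Q lam (s \<otimes>\<^bsub>R\<^esub> b) s"
  using assms lam_Units[OF assms(1)] S_closed Q.Units_closed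
  by (simp add: ore_frac_def lam_mult Q.m_assoc[symmetric])

text \<open>Lets \<open>fraction_grading\<close> fix the degree of the inverse:
  \<open>n - (n + n) = - n\<close>.\<close>

lemma inv_as_left_fraction:
  assumes s: "s \<in> S"
  shows "inv\<^bsub>Q\<^esub> lam s = ore_frac Q lam s (s \<otimes>\<^bsub>R\<^esub> s)"
proof -
  have u: "lam s \<in> Units Q"
    using lam_Units[OF s] .
  have "inv\<^bsub>Q\<^esub> (lam s \<otimes>\<^bsub>Q\<^esub> lam s) = inv\<^bsub>Q\<^esub> lam s \<otimes>\<^bsub>Q\<^esub> inv\<^bsub>Q\<^esub> lam s"
  proof (rule Q.inv_char)
    have "lam s \<otimes>\<^bsub>Q\<^esub> lam s \<otimes>\<^bsub>Q\<^esub> (inv\<^bsub>Q\<^esub> lam s \<otimes>\<^bsub>Q\<^esub> inv\<^bsub>Q\<^esub> lam s) =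
        lam s \<otimes>\<^bsub>Q\<^esub> (lam s \<otimes>\<^bsub>Q\<^esub> inv\<^bsub>Q\<^esub> lam s) \<otimes>\<^bsub>Q\<^esub> inv\<^bsub>Q\<^esub> lam s"
      using u Q.Units_closed[OF u] Q.Units_inv_closed[OF u]
      by (simp add: Q.m_assoc del: Q.Units_r_inv)
    then show "lam s \<otimes>\<^bsub>Q\<^esub> lam s \<otimes>\<^bsub>Q\<^esub> (inv\<^bsub>Q\<^esub> lam s \<otimes>\<^bsub>Q\<^esub> inv\<^bsub>Q\<^esub> lam s) = \<one>\<^bsub>Q\<^esub>"
      using u Q.Units_closed[OF u] by simp
    have "inv\<^bsub>Q\<^esub> lam s \<otimes>\<^bsub>Q\<^esub> inv\<^bsub>Q\<^esub> lam s \<otimes>\<^bsub>Q\<^esub> (lam s \<otimes>\<^bsub>Q\<^esub> lam s) =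
        inv\<^bsub>Q\<^esub> lam s \<otimes>\<^bsub>Q\<^esub> (inv\<^bsub>Q\<^esub> lam s \<otimes>\<^bsub>Q\<^esub> lam s) \<otimes>\<^bsub>Q\<^esub> lam s"
      using u Q.Units_closed[OF u] Q.Units_inv_closed[OF u]
      by (simp add: Q.m_assoc del: Q.Units_l_inv)
    then show "inv\<^bsub>Q\<^esub> lam s \<otimes>\<^bsub>Q\<^esub> inv\<^bsub>Q\<^esub> lam s \<otimes>\<^bsub>Q\<^esub> (lam s \<otimes>\<^bsub>Q\<^esub> lam s) = \<one>\<^bsub>Q\<^esub>"
      using u Q.Units_closed[OF u] by simp
  qed (use u Q.Units_closed[OF u] in auto)
  then show ?thesis
    using s S_closed u Q.Units_closed[OF u] by (simp add: ore_frac_def lam_mult Q.m_assoc)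
qed

text \<open>The condition places each \<open>lam b\<close> and each inverse of \<open>lam s\<close>
  in the expected component of \<open>H\<close>. Their products give
  \<open>fraction_degree n \<subseteq> H n\<close>, and nested gradings of one ring
  coincide.\<close>

lemma fraction_grading_unique:
  assumes H: "graded_ring Q H" and grading: "fraction_grading G S Q lam H"
  shows "H = fraction_degree"
proof -
  interpret H: graded_ring Q H by fact
  interpret F: graded_ring Q fraction_degree by (rule fraction_graded_ring)
  have lamH: "lam b \<in> H n" if b: "b \<in> G n" for b n
  proof -
    obtain s m where s: "s \<in> S" "s \<in> G m"
      using S_nonempty homogeneous by blast
    have "ore_frac Q lam (s \<otimes>\<^bsub>R\<^esub> b) s \<in> H (m + n - m)"
      using grading R.mult_degree[OF s(2) b] s unfolding fraction_grading_def by blast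
    then show ?thesis
      using lam_as_left_fraction[OF s(1) R.degree_closed[OF b]] by simp
  qed
  have invH: "inv\<^bsub>Q\<^esub> lam s \<in> H (- n)" if s: "s \<in> S" "s \<in> G n" for s n
  proof -
    have "ore_frac Q lam s (s \<otimes>\<^bsub>R\<^esub> s) \<in> H (n - (n + n))"
      using grading R.mult_degree[OF s(2) s(2)] S_mult[OF s(1) s(1)] s(2)
      unfolding fraction_grading_def by blast
    then show ?thesis
      using inv_as_left_fraction[OF s(1)] by simp
  qed
  have sub: "q \<in> H n" if q: "q \<in> fraction_degree n" for q n
  proof -
    obtain m s r where s: "q \<in> carrier Q" "s \<in> S" "s \<in> carrier R" "s \<in> G m" "r \<in> carrier R"
      "r \<in> G (n + m)" "q \<otimes>\<^bsub>Q\<^esub> lam s = lam r"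
      using q by (rule fraction_degreeE)
    have "q = lam r \<otimes>\<^bsub>Q\<^esub> inv\<^bsub>Q\<^esub> lam s"
      using s lam_Units[OF s(2)] by (simp flip: s(7) add: Q.m_assoc)
    then show ?thesis
      using H.mult_degree[OF lamH[OF s(6)] invH[OF s(2,4)]] by simp
  qed
  have "q \<in> fraction_degree n" if q: "q \<in> H n" for q n
  proof -
    have qc: "q \<in> carrier Q"
      using q by (rule H.degree_closed)
    \<comment> \<open>By the inclusion, the decomposition of \<open>q\<close> for
      \<open>fraction_degree\<close> is also one for \<open>H\<close>, where decompositions are
      unique.\<close>
    have "H.component q = F.component q"
      by (rule H.component_eqI[OF F.finite_support[OF qc]])
        (use sub F.component_degree[OF qc] F.sum_components[OF qc] in auto)
    then have "q = F.component q n"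
      using H.component_homogeneous[OF q] by metis
    then show ?thesis
      using F.component_degree[OF qc] by metis
  qed
  then show ?thesis
    using sub by blast
qed

end

section \<open>The differential of the localisation\<close>

text \<open>The triple \<open>(a, b, c)\<close> is the matrix with rows \<open>(a, b)\<close> and \<open>(0, c)\<close>.\<close>

definition triangular_ring :: "('b, 'n) ring_scheme \<Rightarrow> ('b \<times> 'b \<times> 'b) ring"
  where "triangular_ring Q =
    \<lparr>carrier = carrier Q \<times> carrier Q \<times> carrier Q,
     monoid.mult = (\<lambda>(a, b, c) (a', b', c').
       (a \<otimes>\<^bsub>Q\<^esub> a', a \<otimes>\<^bsub>Q\<^esub> b' \<oplus>\<^bsub>Q\<^esub> b \<otimes>\<^bsub>Q\<^esub> c', c \<otimes>\<^bsub>Q\<^esub> c')),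
     one = (\<one>\<^bsub>Q\<^esub>, \<zero>\<^bsub>Q\<^esub>, \<one>\<^bsub>Q\<^esub>),
     zero = (\<zero>\<^bsub>Q\<^esub>, \<zero>\<^bsub>Q\<^esub>, \<zero>\<^bsub>Q\<^esub>),
     add = (\<lambda>(a, b, c) (a', b', c'). (a \<oplus>\<^bsub>Q\<^esub> a', b \<oplus>\<^bsub>Q\<^esub> b', c \<oplus>\<^bsub>Q\<^esub> c'))\<rparr>"

lemma triangular_simps [simp]:
  "x \<in> carrier (triangular_ring Q) \<longleftrightarrow>
    fst x \<in> carrier Q \<and> fst (snd x) \<in> carrier Q \<and> snd (snd x) \<in> carrier Q"
  "(a, b, c) \<otimes>\<^bsub>triangular_ring Q\<^esub> (a', b', c') =
    (a \<otimes>\<^bsub>Q\<^esub> a', a \<otimes>\<^bsub>Q\<^esub> b' \<oplus>\<^bsub>Q\<^esub> b \<otimes>\<^bsub>Q\<^esub> c', c \<otimes>\<^bsub>Q\<^esub> c')"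
  "(a, b, c) \<oplus>\<^bsub>triangular_ring Q\<^esub> (a', b', c') = (a \<oplus>\<^bsub>Q\<^esub> a', b \<oplus>\<^bsub>Q\<^esub> b', c \<oplus>\<^bsub>Q\<^esub> c')"
  "\<one>\<^bsub>triangular_ring Q\<^esub> = (\<one>\<^bsub>Q\<^esub>, \<zero>\<^bsub>Q\<^esub>, \<one>\<^bsub>Q\<^esub>)"
  "\<zero>\<^bsub>triangular_ring Q\<^esub> = (\<zero>\<^bsub>Q\<^esub>, \<zero>\<^bsub>Q\<^esub>, \<zero>\<^bsub>Q\<^esub>)"
  by (auto simp: triangular_ring_def mem_Times_iff)

section \<open>Upper triangular matrices over a ring\<close>

context ring
begin

lemma triangular_ring_ring: "ring (triangular_ring R)"
proof (rule ringI)
  show "abelian_group (triangular_ring R)"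
  proof (rule abelian_groupI)
    show "\<exists>y\<in>carrier (triangular_ring R). y \<oplus>\<^bsub>triangular_ring R\<^esub> x = \<zero>\<^bsub>triangular_ring R\<^esub>"
      if "x \<in> carrier (triangular_ring R)" for x
      by (rule bexI[of _ "(\<ominus> fst x, \<ominus> fst (snd x), \<ominus> snd (snd x))"])
        (use that in \<open>cases x, auto simp: l_neg\<close>)
  qed (auto simp: a_ac)
  show "monoid (triangular_ring R)"
    by (rule monoidI) (auto simp: m_assoc l_distr r_distr a_assoc)
qed (auto simp: l_distr r_distr a_ac)

lemma triangular_ring_Units:
  assumes a: "a \<in> Units R" and b: "b \<in> carrier R" and c: "c \<in> Units R"
  shows "(a, b, c) \<in> Units (triangular_ring R)"
proof -
  \<comment> \<open>The off-diagonal entry \<open>y\<close> solves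
    \<open>a \<otimes> y \<oplus> b \<otimes> inv c = \<zero>\<close>.\<close>
  let ?y = "(inv a, \<ominus> (inv a \<otimes> b \<otimes> inv c), inv c)"
  note closed = Units_closed[OF a] b Units_closed[OF c] Units_inv_closed[OF a] Units_inv_closed[OF c]
  have "a \<otimes> (inv a \<otimes> b \<otimes> inv c) = (a \<otimes> inv a) \<otimes> b \<otimes> inv c"
    using closed by (simp add: m_assoc del: Units_r_inv)
  moreover have "inv a \<otimes> b \<otimes> inv c \<otimes> c = inv a \<otimes> b \<otimes> (inv c \<otimes> c)"
    using closed by (simp add: m_assoc del: Units_l_inv)
  ultimately have "(a, b, c) \<otimes>\<^bsub>triangular_ring R\<^esub> ?y = \<one>\<^bsub>triangular_ring R\<^esub>"
    "?y \<otimes>\<^bsub>triangular_ring R\<^esub> (a, b, c) = \<one>\<^bsub>triangular_ring R\<^esub>"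
    using a c closed by (simp_all add: r_minus l_minus l_neg r_neg)
  then show ?thesis
    using closed unfolding Units_def by (auto intro!: bexI[of _ ?y])
qed

end

section \<open>The Leibniz rule for inhomogeneous elements\<close>

context dg_ring
begin

lemma d_closed [simp]: "a \<in> carrier R \<Longrightarrow> d a \<in> carrier R"
  using d_additive by (auto simp: hom_def)

lemma d_add: "a \<in> carrier R \<Longrightarrow> b \<in> carrier R \<Longrightarrow> d (a \<oplus> b) = d a \<oplus> d b"
  using d_additive by (auto simp: hom_def)

text \<open>Needed for the matrix of the unit to be the identity matrix; it follows from the Leibniz
  rule for the product of the unit with itself.\<close>

lemma d_one: "d \<one> = \<zero>"
proof -
  have "d \<one> = d \<one> \<oplus> d \<one>"
    using d_Leibniz[OF one_degree one_closed] by (simp add: signed_def)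
  then show ?thesis
    by (metis d_closed one_closed add.l_cancel_one)
qed

text \<open>The right-hand side is, up to order, the upper right entry of the product of the
  matrices of \<open>a\<close> and \<open>b\<close>.\<close>

lemma d_mult:
  assumes a: "a \<in> carrier R" and b: "b \<in> carrier R"
  shows "d (a \<otimes> b) = d a \<otimes> b \<oplus> parity a \<otimes> d b"
proof (rule additive_eqI[OF abelian_group_axioms _ _ _ a])
  show "(\<lambda>a. d (a \<otimes> b)) \<in> hom (add_monoid R) (add_monoid R)"
    "(\<lambda>a. d a \<otimes> b \<oplus> parity a \<otimes> d b) \<in> hom (add_monoid R) (add_monoid R)"
    using b by (auto simp: hom_def d_add parity_add l_distr a_ac)
  show "d (a \<otimes> b) = d a \<otimes> b \<oplus> parity a \<otimes> d b" if "a \<in> G n" for n a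
    using d_Leibniz[OF that b] degree_closed[OF that] b
    by (simp add: parity_homogeneous[OF that] signed_mult_left)
qed

end

section \<open>Existence, properties and uniqueness of the differential\<close>

locale dg_ore_localised = R: dg_ring R G d + graded_ore_localised R G S Q lam
  for R (structure) and G and d and S and Q (structure) and lam
begin

text \<open>What the matrix extension yields directly. Degree one and square zero are consequences,
  drawn in \<open>derivation_dg_ring\<close>.\<close>

definition derivation :: "('c \<Rightarrow> 'c) \<Rightarrow> bool"
  where "derivation D \<longleftrightarrow> D \<in> hom (add_monoid Q) (add_monoid Q) \<and>
    (\<forall>n. \<forall>q\<in>fraction_degree n. \<forall>q'\<in>carrier Q.
      D (q \<otimes>\<^bsub>Q\<^esub> q') = D q \<otimes>\<^bsub>Q\<^esub> q' \<oplus>\<^bsub>Q\<^esub> signed Q n (q \<otimes>\<^bsub>Q\<^esub> D q')) \<and>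
    (\<forall>r\<in>carrier R. D (lam r) = lam (d r))"

lemma derivation_exists: "\<exists>D. derivation D"
proof -
  define T where "T = triangular_ring Q"
  define h where "h r = (lam (R.parity r), lam (d r), lam r)" for r
  interpret T: ring T
    unfolding T_def by (rule Q.triangular_ring_ring)
  have "h \<in> ring_hom R T"
  proof (rule ring_hom_memI)
    show "h (x \<otimes>\<^bsub>R\<^esub> y) = h x \<otimes>\<^bsub>T\<^esub> h y" if "x \<in> carrier R" "y \<in> carrier R" for x y
      using that Q.a_comm
      by (simp add: h_def T_def R.parity_mult R.d_mult lam_mult lam_add)
  qed (auto simp: h_def T_def R.parity_add R.d_add lam_add R.parity_one R.d_one lam_one lam_zero)
  moreover have "h s \<in> Units T" if s: "s \<in> S" for s
  proof -
    \<comment> \<open>Homogeneity of \<open>s\<close> makes the first diagonal entry equal to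
      \<open>lam s\<close> up to sign, hence a unit.\<close>
    obtain n where n: "s \<in> G n"
      using homogeneous[OF s] by blast
    have "signed Q n (lam s) \<in> Units Q"
      using Q.signed_Units[OF lam_Units[OF s]] .
    moreover have "lam (R.parity s) = signed Q n (lam s)"
      unfolding R.parity_homogeneous[OF n]
      by (rule signed_hom[OF R.abelian_group_axioms Q.abelian_group_axioms lam_additive
            S_closed[OF s]])
    ultimately show ?thesis
      unfolding h_def T_def using lam_Units[OF s] S_closed[OF s]
      by (intro Q.triangular_ring_Units) auto
  qed
  ultimately interpret ore_extension R S Q lam T h
    by unfold_locales auto
  obtain g where g: "g \<in> ring_hom Q T" and g_lam: "\<And>r. r \<in> carrier R \<Longrightarrow> g (lam r) = h r"
    using universal_property by blast
  define \<sigma> D \<iota> where "\<sigma> q = fst (g q)" and "D q = fst (snd (g q))"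
    and "\<iota> q = snd (snd (g q))" for q
  have g_eq: "g q = (\<sigma> q, D q, \<iota> q)" for q
    by (simp add: \<sigma>_def D_def \<iota>_def)
  have closed: "\<sigma> q \<in> carrier Q" "D q \<in> carrier Q" "\<iota> q \<in> carrier Q" if "q \<in> carrier Q" for q
    using ring_hom_closed[OF g that] by (auto simp: T_def g_eq)
  have add: "D (q \<oplus>\<^bsub>Q\<^esub> q') = D q \<oplus>\<^bsub>Q\<^esub> D q'"
    if "q \<in> carrier Q" "q' \<in> carrier Q" for q q'
    using ring_hom_add[OF g that] by (simp add: T_def g_eq)
  have mult: "\<sigma> (q \<otimes>\<^bsub>Q\<^esub> q') = \<sigma> q \<otimes>\<^bsub>Q\<^esub> \<sigma> q'"
    "D (q \<otimes>\<^bsub>Q\<^esub> q') = \<sigma> q \<otimes>\<^bsub>Q\<^esub> D q' \<oplus>\<^bsub>Q\<^esub> D q \<otimes>\<^bsub>Q\<^esub> \<iota> q'" "\<iota> (q \<otimes>\<^bsub>Q\<^esub> q') = \<iota> q \<otimes>\<^bsub>Q\<^esub> \<iota> q'"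
    if "q \<in> carrier Q" "q' \<in> carrier Q" for q q'
    using ring_hom_mult[OF g that] by (simp_all add: T_def g_eq)
  have lam: "\<sigma> (lam r) = lam (R.parity r)" "D (lam r) = lam (d r)" "\<iota> (lam r) = lam r"
    if "r \<in> carrier R" for r
    using g_lam[OF that] by (simp_all add: h_def g_eq)
  \<comment> \<open>The lower diagonal entry is multiplicative and fixes the image of
    \<open>lam\<close>; cancelling the denominator shows that it fixes every
    \<open>q\<close>.\<close>
  have \<iota>_id: "\<iota> q = q" if q: "q \<in> carrier Q" for q
  proof -
    obtain s r where s: "s \<in> S" and r: "r \<in> carrier R" and eq: "q \<otimes>\<^bsub>Q\<^esub> lam s = lam r"
      using fraction[OF q] by blast
    have "\<iota> q \<otimes>\<^bsub>Q\<^esub> lam s = q \<otimes>\<^bsub>Q\<^esub> lam s"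
      using mult(3)[OF q lam_closed[OF S_closed[OF s]]] S_closed[OF s] r by (simp add: lam eq)
    then show ?thesis
      by (rule Q.Units_r_cancel) (use lam_Units[OF s] closed(3)[OF q] q in auto)
  qed
  \<comment> \<open>By multiplicativity the sign of \<open>q\<close> times that of \<open>s\<close>
    is that of \<open>r\<close>. The sign of \<open>s\<close> is its own inverse, which leaves the
    sign of degree \<open>n\<close>.\<close>
  have \<sigma>_degree: "\<sigma> q = signed Q n q" if q: "q \<in> fraction_degree n" for q n
  proof -
    obtain m s r where s: "q \<in> carrier Q" "s \<in> S" "s \<in> carrier R" "s \<in> G m" "r \<in> carrier R"
      "r \<in> G (n + m)" and eq: "q \<otimes>\<^bsub>Q\<^esub> lam s = lam r"
      using q by (rule fraction_degreeE)
    have parity: "lam (R.parity x) = signed Q k (lam x)" if "x \<in> G k" for x k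
      unfolding R.parity_homogeneous[OF that]
      by (rule signed_hom[OF R.abelian_group_axioms Q.abelian_group_axioms lam_additive
            R.degree_closed[OF that]])
    have "signed Q m (\<sigma> q \<otimes>\<^bsub>Q\<^esub> lam s) = \<sigma> q \<otimes>\<^bsub>Q\<^esub> \<sigma> (lam s)"
      using s closed(1) by (simp add: lam parity Q.signed_mult_right)
    also have "\<dots> = signed Q (n + m) (q \<otimes>\<^bsub>Q\<^esub> lam s)"
      using mult(1)[OF s(1) lam_closed[OF s(3)]] s(5,6) by (simp add: eq lam parity)
    finally have "signed Q m (signed Q m (\<sigma> q \<otimes>\<^bsub>Q\<^esub> lam s)) =
        signed Q m (signed Q (n + m) (q \<otimes>\<^bsub>Q\<^esub> lam s))"
      by simp
    then have "\<sigma> q \<otimes>\<^bsub>Q\<^esub> lam s = signed Q n q \<otimes>\<^bsub>Q\<^esub> lam s"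
      using s closed(1)[OF s(1)] by (simp add: Q.signed_twice Q.signed_mult_left)
    then show ?thesis
      by (rule Q.Units_r_cancel) (use lam_Units[OF s(2)] closed(1) s(1) in auto)
  qed
  have "D (q \<otimes>\<^bsub>Q\<^esub> q') = D q \<otimes>\<^bsub>Q\<^esub> q' \<oplus>\<^bsub>Q\<^esub> signed Q n (q \<otimes>\<^bsub>Q\<^esub> D q')"
    if q: "q \<in> fraction_degree n" "q' \<in> carrier Q" for q q' n
    using mult(2)[OF fraction_degree_closed[OF q(1)] q(2)] closed q fraction_degree_closed[OF q(1)]
    by (simp add: \<iota>_id \<sigma>_degree Q.signed_mult_left Q.a_comm)
  then have "derivation D"
    unfolding derivation_def using closed(2) add lam(2) by (auto simp: hom_def)
  then show ?thesis
    by blast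
qed

lemma derivation_dg_ring:
  assumes "derivation D"
  shows "dg_ring Q fraction_degree D"
proof -
  interpret F: graded_ring Q fraction_degree
    by (rule fraction_graded_ring)
  have hom: "D \<in> hom (add_monoid Q) (add_monoid Q)"
    using assms by (simp add: derivation_def)
  have closed: "D q \<in> carrier Q" if "q \<in> carrier Q" for q
    using hom that by (auto simp: hom_def)
  have add: "D (q \<oplus>\<^bsub>Q\<^esub> q') = D q \<oplus>\<^bsub>Q\<^esub> D q'" if "q \<in> carrier Q" "q' \<in> carrier Q" for q q'
    using hom that by (auto simp: hom_def)
  have signed: "D (signed Q n q) = signed Q n (D q)" if "q \<in> carrier Q" for q n
    by (rule signed_hom[OF Q.abelian_group_axioms Q.abelian_group_axioms hom that])
  have Leibniz: "D (q \<otimes>\<^bsub>Q\<^esub> q') = D q \<otimes>\<^bsub>Q\<^esub> q' \<oplus>\<^bsub>Q\<^esub> signed Q n (q \<otimes>\<^bsub>Q\<^esub> D q')"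
    if "q \<in> fraction_degree n" "q' \<in> carrier Q" for q q' n
    using assms that by (simp add: derivation_def)
  have lam: "D (lam r) = lam (d r)" if "r \<in> carrier R" for r
    using assms that by (simp add: derivation_def)
  have degree: "D q \<in> fraction_degree (n + 1)" if q: "q \<in> fraction_degree n" for q n
  proof -
    obtain m s r where s: "q \<in> carrier Q" "s \<in> S" "s \<in> carrier R" "s \<in> G m" "r \<in> carrier R"
      "r \<in> G (n + m)" and eq: "q \<otimes>\<^bsub>Q\<^esub> lam s = lam r"
      using q by (rule fraction_degreeE)
    \<comment> \<open>The second Leibniz term for \<open>q \<otimes> lam s\<close>. Since
      \<open>lam (d r)\<close> and \<open>?y\<close> both have degree \<open>n + m + 1\<close>, so
      has \<open>D q \<otimes> lam s\<close>; dividing by \<open>lam s\<close> leaves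
      \<open>n + 1\<close>.\<close>
    let ?y = "signed Q n (q \<otimes>\<^bsub>Q\<^esub> lam (d s))"
    have y: "?y \<in> fraction_degree (n + m + 1)"
      using fraction_degree_mult[OF q lam_degree[OF R.d_degree[OF s(4)]]]
      by (simp add: F.degree_signed add.assoc)
    have yc: "?y \<in> carrier Q"
      using s by simp
    have "lam (d r) = D q \<otimes>\<^bsub>Q\<^esub> lam s \<oplus>\<^bsub>Q\<^esub> ?y"
      using Leibniz[OF q lam_closed[OF s(3)]] s by (simp add: eq lam)
    then have "D q \<otimes>\<^bsub>Q\<^esub> lam s = lam (d r) \<ominus>\<^bsub>Q\<^esub> ?y"
      using s(3) closed[OF s(1)] yc by (simp add: Q.minus_eq Q.a_assoc Q.r_neg)
    then have "D q \<otimes>\<^bsub>Q\<^esub> lam s \<in> fraction_degree (n + m + 1)"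
      using lam_degree[OF R.d_degree[OF s(6)]] y
      by (simp add: Q.minus_eq fraction_degree_add fraction_degree_minus)
    from fraction_degree_mult[OF this fraction_degree_inv[OF s(2,4)]]
    show ?thesis
      using s(3) closed[OF s(1)] lam_Units[OF s(2)] by (simp add: Q.m_assoc add.commute)
  qed
  have square_homogeneous: "D (D q) = \<zero>\<^bsub>Q\<^esub>" if q: "q \<in> fraction_degree n" for q n
  proof -
    obtain m s r where s: "q \<in> carrier Q" "s \<in> S" "s \<in> carrier R" "s \<in> G m" "r \<in> carrier R"
      "r \<in> G (n + m)" and eq: "q \<otimes>\<^bsub>Q\<^esub> lam s = lam r"
      using q by (rule fraction_degreeE)
    let ?z = "D q \<otimes>\<^bsub>Q\<^esub> lam (d s)"
    have c: "D q \<in> carrier Q" "D (D q) \<in> carrier Q" "?z \<in> carrier Q"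
      using closed s by auto
    \<comment> \<open>Expanding \<open>D\<close> twice yields the mixed term \<open>?z\<close> with
      the signs of \<open>n + 1\<close> and of \<open>n\<close>, which cancel. The term with
      \<open>d (d s)\<close> vanishes, so only \<open>D (D q) \<otimes> lam s\<close>
      survives.\<close>
    have "\<zero>\<^bsub>Q\<^esub> = D (D (q \<otimes>\<^bsub>Q\<^esub> lam s))"
      using s by (simp add: eq lam R.d_square lam_zero)
    also have "\<dots> = D (D q \<otimes>\<^bsub>Q\<^esub> lam s) \<oplus>\<^bsub>Q\<^esub> signed Q n (D (q \<otimes>\<^bsub>Q\<^esub> lam (d s)))"
      using Leibniz[OF q] s c by (simp add: lam add signed)
    also have "D (D q \<otimes>\<^bsub>Q\<^esub> lam s) = D (D q) \<otimes>\<^bsub>Q\<^esub> lam s \<oplus>\<^bsub>Q\<^esub> signed Q (n + 1) ?z"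
      using Leibniz[OF degree[OF q]] s by (simp add: lam)
    also have "D (q \<otimes>\<^bsub>Q\<^esub> lam (d s)) = ?z"
      using Leibniz[OF q] s c by (simp add: lam R.d_square lam_zero)
    finally have "D (D q) \<otimes>\<^bsub>Q\<^esub> lam s = \<zero>\<^bsub>Q\<^esub>"
      using c s by (simp add: Q.signed_succ Q.a_assoc Q.l_neg)
    then have "D (D q) \<otimes>\<^bsub>Q\<^esub> lam s = \<zero>\<^bsub>Q\<^esub> \<otimes>\<^bsub>Q\<^esub> lam s"
      using s by simp
    then show ?thesis
      by (rule Q.Units_r_cancel) (use c lam_Units[OF s(2)] in auto)
  qed
  have "D (D q) = \<zero>\<^bsub>Q\<^esub>" if q: "q \<in> carrier Q" for q
  proof (rule F.additive_eqI[OF Q.abelian_group_axioms _ Q.additive_const_zero _ q])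
    show "(\<lambda>q. D (D q)) \<in> hom (add_monoid Q) (add_monoid Q)"
      using closed by (auto simp: hom_def add)
  qed (rule square_homogeneous)
  then show ?thesis
    using hom degree Leibniz by unfold_locales auto
qed

text \<open>With \<open>x\<close> the fraction of \<open>b\<close> by \<open>s\<close>, apply the
  Leibniz rule to \<open>lam s \<otimes> x = lam b\<close>, divide by \<open>lam s\<close> on the
  left and solve for \<open>D x\<close>. Moving the term with \<open>d s\<close> across accounts for
  the sign of \<open>n + 1\<close>. Only the left factor \<open>lam s\<close> has to be homogeneous,
  so \<open>b\<close> is arbitrary.\<close>

lemma derivation_fraction_differential:
  assumes "derivation D"
  shows "fraction_differential R G d S Q lam D"
  unfolding fraction_differential_def
proof (intro ballI allI)
  fix b n s
  assume b: "b \<in> carrier R" and sn: "s \<in> S \<inter> G n"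
  then have s: "s \<in> S" "s \<in> G n" "s \<in> carrier R"
    using S_closed by auto
  have u: "lam s \<in> Units Q" and v: "inv\<^bsub>Q\<^esub> lam s \<in> carrier Q"
    using lam_Units[OF s(1)] by auto
  define x where "x = ore_frac Q lam b s"
  define y where "y = ore_frac Q lam (d s) s \<otimes>\<^bsub>Q\<^esub> x"
  have closed: "x \<in> carrier Q" "y \<in> carrier Q" "D x \<in> carrier Q"
    using assms b s v by (auto simp: x_def y_def ore_frac_def derivation_def hom_def)
  have x: "lam s \<otimes>\<^bsub>Q\<^esub> x = lam b"
    using b s u v by (simp add: x_def ore_frac_def Q.m_assoc[symmetric])
  have "lam (d b) = D (lam s \<otimes>\<^bsub>Q\<^esub> x)"
    using assms b by (simp add: x derivation_def)
  also have "\<dots> = lam (d s) \<otimes>\<^bsub>Q\<^esub> x \<oplus>\<^bsub>Q\<^esub> signed Q n (lam s \<otimes>\<^bsub>Q\<^esub> D x)"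
    using assms lam_degree[OF s(2)] closed s(3) by (simp add: derivation_def)
  finally have "ore_frac Q lam (d b) s =
      inv\<^bsub>Q\<^esub> lam s \<otimes>\<^bsub>Q\<^esub> (lam (d s) \<otimes>\<^bsub>Q\<^esub> x \<oplus>\<^bsub>Q\<^esub> signed Q n (lam s \<otimes>\<^bsub>Q\<^esub> D x))"
    by (simp add: ore_frac_def)
  also have "\<dots> = y \<oplus>\<^bsub>Q\<^esub> signed Q n (D x)"
    using closed s u v
    by (simp add: y_def ore_frac_def Q.r_distr Q.signed_mult_right Q.m_assoc[symmetric])
  finally have "signed Q (n + 1) y \<oplus>\<^bsub>Q\<^esub> signed Q n (ore_frac Q lam (d b) s) =
      signed Q (n + 1) y \<oplus>\<^bsub>Q\<^esub> (signed Q n y \<oplus>\<^bsub>Q\<^esub> D x)"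
    using closed by (simp add: Q.signed_add Q.signed_signed Q.signed_even)
  also have "\<dots> = D x"
    using closed by (simp add: Q.signed_succ Q.a_assoc[symmetric] Q.l_neg)
  finally show "D (ore_frac Q lam b s) =
      signed Q (n + 1) (ore_frac Q lam (d s) s \<otimes>\<^bsub>Q\<^esub> ore_frac Q lam b s)
        \<oplus>\<^bsub>Q\<^esub> signed Q n (ore_frac Q lam (d b) s)"
    by (simp add: x_def y_def)
qed

text \<open>The formula forces agreement on the image of \<open>lam\<close>, as each
  \<open>lam b\<close> is a left fraction. The Leibniz rule for
  \<open>q \<otimes> lam s = lam r\<close> carries this to homogeneous right fractions, and
  additivity to all of \<open>Q\<close>.\<close>

lemma differential_unique:
  assumes D: "derivation D" and D': "dg_ring Q fraction_degree D'"
    and frac: "fraction_differential R G d S Q lam D'" and q: "q \<in> carrier Q"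
  shows "D' q = D q"
proof -
  interpret D: dg_ring Q fraction_degree D
    using D by (rule derivation_dg_ring)
  interpret D': dg_ring Q fraction_degree D'
    by (rule D')
  have lam: "D' (lam b) = D (lam b)" if b: "b \<in> carrier R" for b
  proof -
    obtain s n where s: "s \<in> S" "s \<in> G n"
      using S_nonempty homogeneous by blast
    then have "s \<in> S \<inter> G n" "s \<otimes>\<^bsub>R\<^esub> b \<in> carrier R"
      using b S_closed by auto
    then show ?thesis
      using frac derivation_fraction_differential[OF D]
      unfolding fraction_differential_def lam_as_left_fraction[OF s(1) b] by metis
  qed
  show ?thesis
  proof (rule D.additive_eqI[OF Q.abelian_group_axioms D'.d_additive D.d_additive _ q])
    fix n q
    assume q: "q \<in> fraction_degree n"
    obtain m s r where s: "q \<in> carrier Q" "s \<in> S" "s \<in> carrier R" "s \<in> G m" "r \<in> carrier R"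
      "r \<in> G (n + m)" and eq: "q \<otimes>\<^bsub>Q\<^esub> lam s = lam r"
      using q by (rule fraction_degreeE)
    have "D' q \<otimes>\<^bsub>Q\<^esub> lam s \<oplus>\<^bsub>Q\<^esub> signed Q n (q \<otimes>\<^bsub>Q\<^esub> D (lam s)) =
        D q \<otimes>\<^bsub>Q\<^esub> lam s \<oplus>\<^bsub>Q\<^esub> signed Q n (q \<otimes>\<^bsub>Q\<^esub> D (lam s))"
      using D.d_Leibniz[OF q lam_closed[OF s(3)]] D'.d_Leibniz[OF q lam_closed[OF s(3)]]
        lam[OF s(3)] lam[OF s(5)] by (simp add: eq)
    then have "D' q \<otimes>\<^bsub>Q\<^esub> lam s = D q \<otimes>\<^bsub>Q\<^esub> lam s"
      using s(1,3) by (subst (asm) Q.add.right_cancel) auto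
    then show "D' q = D q"
      by (rule Q.Units_r_cancel) (use s(1) lam_Units[OF s(2)] in auto)
  qed
qed

end

theorem theorem2p6:
  fixes R :: "('a, 'm) ring_scheme" and G :: "int \<Rightarrow> 'a set" and d :: "'a \<Rightarrow> 'a"
    and S :: "'a set" and Q :: "('b, 'n) ring_scheme" and lam :: "'a \<Rightarrow> 'b"
  assumes "dg_ring R G d"
    and "multiplicative_set R S"
    and "\<forall>s\<in>S. \<exists>n. s \<in> G n"
    and "(\<forall>s\<in>S. regular_element R s) \<or>
         ((\<forall>s\<in>S. d s = \<zero>\<^bsub>R\<^esub>) \<and> ore_set R S \<and>
          (\<forall>s\<in>S. regular_element (R Quot ass R S) (ass R S +>\<^bsub>R\<^esub> s)))"
    and "ore_localisation R S Q lam"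
  shows "\<exists>H dS.
    dg_ring Q H dS \<and> fraction_grading G S Q lam H \<and> fraction_differential R G d S Q lam dS \<and>
    (\<forall>H' dS'. dg_ring Q H' dS' \<and> fraction_grading G S Q lam H' \<and>
        fraction_differential R G d S Q lam dS' \<longrightarrow>
        H' = H \<and> (\<forall>q\<in>carrier Q. dS' q = dS q)) \<and>
    dg_ring_hom R G d Q H dS lam \<and>
    lam ` S \<subseteq> Units Q \<and>
    (\<forall>q\<in>carrier Q. \<exists>s\<in>S. q \<otimes>\<^bsub>Q\<^esub> lam s \<in> lam ` carrier R)"
proof -
  interpret R: dg_ring R G d
    by fact
  interpret Q: ring Q
    using assms(5) by (simp add: ore_localisation_def)
  interpret dg_ore_localised R G d S Q lam
    by unfold_locales (use assms in auto)
  obtain D where D: "derivation D"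
    using derivation_exists by blast
  have unique: "\<forall>H' dS'. dg_ring Q H' dS' \<and> fraction_grading G S Q lam H' \<and>
      fraction_differential R G d S Q lam dS' \<longrightarrow>
      H' = fraction_degree \<and> (\<forall>q\<in>carrier Q. dS' q = D q)"
  proof (intro allI impI)
    fix H' dS'
    assume H': "dg_ring Q H' dS' \<and> fraction_grading G S Q lam H' \<and>
      fraction_differential R G d S Q lam dS'"
    \<comment> \<open>The gradings are compared first, because the signs in the Leibniz rule of
      \<open>dS'\<close> refer to \<open>H'\<close>.\<close>
    then have eq: "H' = fraction_degree"
      by (intro fraction_grading_unique) (simp_all add: dg_ring_def)
    with H' show "H' = fraction_degree \<and> (\<forall>q\<in>carrier Q. dS' q = D q)"
      using differential_unique[OF D, of dS'] by simp
  qed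
  have hom: "dg_ring_hom R G d Q fraction_degree D lam"
    using lam_hom lam_degree D by (auto simp: dg_ring_hom_def derivation_def)
  have units: "lam ` S \<subseteq> Units Q"
    using lam_Units by blast
  have image: "\<forall>q\<in>carrier Q. \<exists>s\<in>S. q \<otimes>\<^bsub>Q\<^esub> lam s \<in> lam ` carrier R"
    using fraction by blast
  show ?thesis
    by (intro exI[of _ fraction_degree] exI[of _ D] conjI)
      (fact derivation_dg_ring[OF D] fraction_degree_fraction_grading
        derivation_fraction_differential[OF D] unique hom units image)+
qed

end
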